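(* Let $\mathbb{K}$ be an algebraically closed field of characteristic zero. Let $p<q$ be coprime positive integers, let $l$ be a positive integer, and let $X$ be an $\mathrm{SL}(2)/\mathbb{Z}_{l(q-p)}$-embedding of height $p/q$. Then the cone corresponding to $X$ regarded as a toric variety is $$\mathrm{cone}\bigl((1,0,0),\,(0,1,0),\,(-1,0,lq),\,(0,-1,lp)\bigr)\subset N_{\mathbb{Q}}=\mathbb{Q}^3,\qquad N=\mathbb{Z}^3,$$ that is, $\mathbb{K}[X]\cong\mathbb{K}[M\cap\widehat{\sigma}]$, where $\sigma=\mathrm{cone}\bigl((1,0,0),\,(0,1,0),\,(-1,0,lq),\,(0,-1,lp)\bigr)$, $M=\mathrm{Hom}(N,\mathbb{Z})$ and $\widehat{\sigma}\subset M_{\mathbb{Q}}$ is the dual cone.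
   Context: An affine toric variety (a normal affine variety with a locally transitive action of an algebraic torus $T$) corresponds to a strongly convex rational polyhedral cone $\sigma$ in $N_{\mathbb{Q}}=N\otimes\mathbb{Q}$, where $M=\mathfrak{X}(T)$ and $N=\mathrm{Hom}(M,\mathbb{Z})$, via $\mathbb{K}[X]\cong\mathbb{K}[M\cap\widehat{\sigma}]$; here coordinates in $N$ are taken with respect to a suitable basis. $\mathrm{SL}(2)/\mathbb{Z}_r$-embeddings. An (affine) $\mathrm{SL}(2)/\mathbb{Z}_r$-embedding is a normal affine irreducible three-dimensional variety with a regular $\mathrm{SL}(2)$-action that has an open orbit but is not transitive and for which the stabilizer of a point of the open orbit is cyclic of order $r$. For $r=1$ it is called an $\mathrm{SL}(2)$-embedding. Height (Popov). Let $\alpha,\beta,\gamma,\delta$ be the matrix-entry functions on $\mathrm{SL}(2)$: $\alpha(A)=a_{11},\beta(A)=a_{12},\gamma(A)=a_{21},\delta(A)=a_{22}$. Let $U$ be the group of lower unitriangular matrices, acting on $\mathrm{SL}(2)$ by left shifts; then $\mathbb{K}[\mathrm{SL}(2)]^U=\mathbb{K}[\alpha,\beta]$. If $Y$ is an $\mathrm{SL}(2)$-embedding, then for a suitable open equivariant embedding $\varphi\colon\mathrm{SL}(2)\hookrightarrow Y$ (with $\mathrm{SL}(2)$ acting on itself by left shifts) the image $\varphi^*(\mathbb{K}[Y]^U)\subset\mathbb{K}[\alpha,\beta]$ is the linear span of the monomials $\alpha^i\beta^j$ with $j\le hi$, for a unique rational number $h\in(0,1]$, called the height of $Y$; $Y$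 is determined by $h$ up to equivariant isomorphism. For an $\mathrm{SL}(2)/\mathbb{Z}_r$-embedding $X$ there is a unique (up to isomorphism) $\mathrm{SL}(2)$-embedding $Y$ with $X\cong Y/\!\!/\mathbb{Z}_r$ equivariantly, where $\mathbb{Z}_r=\{\mathrm{diag}(\varepsilon,\varepsilon^{-1}):\varepsilon^r=1\}$ acts on $Y$ by the extension of its action on $\mathrm{SL}(2)$ by right shifts; the height of $X$ is the height of $Y$. The pairs $(h,r)$ with $h\in\mathbb{Q}\cap(0,1]$, $r\in\mathbb{N}$, classify $\mathrm{SL}(2)/\mathbb{Z}_r$-embeddings up to equivariant isomorphism. *)

theory Defs
  imports
    "HOL-Analysis.Analysis"
    "HOL-Algebra.Group_Action"
    "HOL-Algebra.Elementary_Groups"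
    "HOL-Algebra.Module"
    "HOL-Algebra.QuotRing"
    "HOL-Library.Poly_Mapping"
    "HOL-Library.Extended_Nat"
begin

section \<open>Affine varieties\<close>

text \<open>
  A space is described by the set C of its coordinate functions; its polynomial functions are the
  K-algebra generated by C.
\<close>

inductive_set polyfun :: "('a \<Rightarrow> 'k) set \<Rightarrow> ('a \<Rightarrow> 'k::field) set"
  for C :: "('a \<Rightarrow> 'k) set" where
  const: "(\<lambda>_. c) \<in> polyfun C"
| coord: "f \<in> C \<Longrightarrow> f \<in> polyfun C"
| add: "f \<in> polyfun C \<Longrightarrow> g \<in> polyfun C \<Longrightarrow> (\<lambda>x. f x + g x) \<in> polyfun C"
| mult: "f \<in> polyfun C \<Longrightarrow> g \<in> polyfun C \<Longrightarrow> (\<lambda>x. f x * g x) \<in> polyfun C"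

definition vec_coords :: "((nat \<Rightarrow> 'k) \<Rightarrow> 'k::field) set"
  where "vec_coords = range (\<lambda>i x. x i)"

definition mat_coords :: "('k^2^2 \<Rightarrow> 'k::field) set"
  where "mat_coords = {\<lambda>A. A $ i $ j | i j. True}"

definition prod_coords ::
    "('a \<Rightarrow> 'k) set \<Rightarrow> ('b \<Rightarrow> 'k) set \<Rightarrow> ('a \<times> 'b \<Rightarrow> 'k::field) set"
  where "prod_coords C D = {f \<circ> fst | f. f \<in> C} \<union> {g \<circ> snd | g. g \<in> D}"

text \<open>
  A point of affine n-space is a sequence vanishing from index n on. This lets the dimension of the
  ambient space be quantified inside definitions; on such sequences the superfluous coordinate
  functions are zero. Affine varieties are represented by their closed embeddings, as algebraic sets.
\<close>

definition affine_space :: "nat \<Rightarrow> (nat \<Rightarrow> 'k::field) set"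
  where "affine_space n = {x. \<forall>i\<ge>n. x i = 0}"

definition algebraic_set :: "(nat \<Rightarrow> 'k::field) set \<Rightarrow> bool"
  where "algebraic_set X \<longleftrightarrow>
    (\<exists>n S. S \<subseteq> polyfun vec_coords \<and> X = {x \<in> affine_space n. \<forall>f\<in>S. f x = 0})"

definition zariski_open_in :: "(nat \<Rightarrow> 'k::field) set \<Rightarrow> (nat \<Rightarrow> 'k) set \<Rightarrow> bool"
  where "zariski_open_in X U \<longleftrightarrow> U \<subseteq> X \<and> algebraic_set (X - U)"

definition irreducible_set :: "(nat \<Rightarrow> 'k::field) set \<Rightarrow> bool"
  where "irreducible_set X \<longleftrightarrow> X \<noteq> {} \<and>
    (\<forall>Z1 Z2. algebraic_set Z1 \<and> algebraic_set Z2 \<and> X \<subseteq> Z1 \<union> Z2 \<longrightarrow> X \<subseteq> Z1 \<or> X \<subseteq> Z2)"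

definition krull_dim :: "(nat \<Rightarrow> 'k::field) set \<Rightarrow> enat"
  where "krull_dim X = Sup {enat d | d. \<exists>Z.
    (\<forall>i\<le>d. algebraic_set (Z i) \<and> irreducible_set (Z i) \<and> Z i \<subseteq> X) \<and> (\<forall>i<d. Z i \<subset> Z (Suc i))}"

text \<open>
  Functions on X are made extensional, so that equality in K[X] is equality on X.
\<close>

definition coord_ring :: "(nat \<Rightarrow> 'k::field) set \<Rightarrow> ('k, (nat \<Rightarrow> 'k) \<Rightarrow> 'k) module"
  where "coord_ring X =
    \<lparr>carrier = {restrict f X | f. f \<in> polyfun vec_coords},
     monoid.mult = (\<lambda>f g. \<lambda>x\<in>X. f x * g x), one = (\<lambda>x\<in>X. 1),
     zero = (\<lambda>x\<in>X. 0), add = (\<lambda>f g. \<lambda>x\<in>X. f x + g x),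
     smult = (\<lambda>c f. \<lambda>x\<in>X. c * f x)\<rparr>"

text \<open>
  For irreducible X: K[X] is integrally closed in its field of fractions. Here f/g is integral over
  K[X] iff it is a root of a monic polynomial of degree n with lower coefficients a i in K[X]; the
  equation is written after multiplication by the n-th power of g.
\<close>

definition normal_set :: "(nat \<Rightarrow> 'k::field) set \<Rightarrow> bool"
  where "normal_set X \<longleftrightarrow>
    (\<forall>f\<in>carrier (coord_ring X). \<forall>g\<in>carrier (coord_ring X). \<forall>n>0. \<forall>a.
      (\<exists>x\<in>X. g x \<noteq> 0) \<longrightarrow>
      (\<forall>i<n. a i \<in> carrier (coord_ring X)) \<longrightarrow>
      (\<forall>x\<in>X. f x ^ n + (\<Sum>i<n. a i x * f x ^ i * g x ^ (n - i)) = 0) \<longrightarrow>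
      (\<exists>h\<in>carrier (coord_ring X). \<forall>x\<in>X. f x = h x * g x))"

definition morphism_on ::
    "('a \<Rightarrow> 'k::field) set \<Rightarrow> 'a set \<Rightarrow> ('b \<Rightarrow> 'k) set \<Rightarrow> 'b set \<Rightarrow> ('a \<Rightarrow> 'b) \<Rightarrow> bool"
  where "morphism_on C X D Y F \<longleftrightarrow>
    F \<in> X \<rightarrow> Y \<and> (\<forall>d\<in>D. \<exists>f\<in>polyfun C. \<forall>x\<in>X. d (F x) = f x)"

text \<open>Regular functions on a quasi-affine set are locally quotients of polynomial functions.\<close>

definition locally_regular_on :: "(nat \<Rightarrow> 'k::field) set \<Rightarrow> ((nat \<Rightarrow> 'k) \<Rightarrow> 'k) \<Rightarrow> bool"
  where "locally_regular_on U F \<longleftrightarrow>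
    (\<forall>x\<in>U. \<exists>f\<in>polyfun vec_coords. \<exists>g\<in>polyfun vec_coords.
      g x \<noteq> 0 \<and> (\<forall>y\<in>U. g y \<noteq> 0 \<longrightarrow> F y = f y / g y))"


section \<open>Embeddings of SL(2) modulo a cyclic group\<close>

definition SL2 :: "('k::field^2^2) set"
  where "SL2 = {A. det A = 1}"

definition SL2_group :: "('k::field^2^2) monoid"
  where "SL2_group = \<lparr>carrier = SL2, monoid.mult = (**), one = mat 1\<rparr>"

definition lower_unitriangular :: "('k::field^2^2) set"
  where "lower_unitriangular = {A. A $ 1 $ 1 = 1 \<and> A $ 1 $ 2 = 0 \<and> A $ 2 $ 2 = 1}"

definition Z_subgroup :: "nat \<Rightarrow> ('k::field^2^2) set"
  where "Z_subgroup r = {vector [vector [e, 0], vector [0, inverse e]] | e. e ^ r = 1}"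

definition regular_SL2_action ::
    "(nat \<Rightarrow> 'k::field) set \<Rightarrow> ('k^2^2 \<Rightarrow> (nat \<Rightarrow> 'k) \<Rightarrow> (nat \<Rightarrow> 'k)) \<Rightarrow> bool"
  where "regular_SL2_action X act \<longleftrightarrow>
    group_action SL2_group X act \<and>
    morphism_on (prod_coords mat_coords vec_coords) (SL2 \<times> X) vec_coords X (\<lambda>(A, x). act A x)"

definition SL2_mod_Z_embedding ::
    "nat \<Rightarrow> (nat \<Rightarrow> 'k::field) set \<Rightarrow> ('k^2^2 \<Rightarrow> (nat \<Rightarrow> 'k) \<Rightarrow> (nat \<Rightarrow> 'k)) \<Rightarrow> bool"
  where "SL2_mod_Z_embedding r X act \<longleftrightarrow>
    algebraic_set X \<and> irreducible_set X \<and> normal_set X \<and> krull_dim X = 3 \<and>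
    regular_SL2_action X act \<and>
    (\<exists>x\<in>X. zariski_open_in X (orbit SL2_group act x) \<and> orbit SL2_group act x \<noteq> X \<and>
       cyclic_group (SL2_group\<lparr>carrier := stabilizer SL2_group act x\<rparr>) \<and>
       card (stabilizer SL2_group act x) = r)"

definition open_equivariant_embedding ::
    "(nat \<Rightarrow> 'k::field) set \<Rightarrow> ('k^2^2 \<Rightarrow> (nat \<Rightarrow> 'k) \<Rightarrow> (nat \<Rightarrow> 'k)) \<Rightarrow>
     ('k^2^2 \<Rightarrow> (nat \<Rightarrow> 'k)) \<Rightarrow> bool"
  where "open_equivariant_embedding Y act \<phi> \<longleftrightarrow>
    morphism_on mat_coords SL2 vec_coords Y \<phi> \<and> inj_on \<phi> SL2 \<and>
    zariski_open_in Y (\<phi> ` SL2) \<and>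
    (\<forall>i j. locally_regular_on (\<phi> ` SL2) (\<lambda>y. inv_into SL2 \<phi> y $ i $ j)) \<and>
    (\<forall>A\<in>SL2. \<forall>B\<in>SL2. \<phi> (A ** B) = act A (\<phi> B))"

definition invariant_functions ::
    "'g set \<Rightarrow> ('g \<Rightarrow> (nat \<Rightarrow> 'k) \<Rightarrow> (nat \<Rightarrow> 'k)) \<Rightarrow> (nat \<Rightarrow> 'k::field) set \<Rightarrow> ((nat \<Rightarrow> 'k) \<Rightarrow> 'k) set"
  where "invariant_functions H act Y =
    {f \<in> carrier (coord_ring Y). \<forall>g\<in>H. \<forall>y\<in>Y. f (act g y) = f y}"

text \<open>
  The entries of the first row generate the functions on SL(2) invariant under left shifts by lower
  unitriangular matrices.
\<close>

definition height_span :: "rat \<Rightarrow> ('k::field^2^2 \<Rightarrow> 'k) set"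
  where "height_span h =
    {\<lambda>A\<in>SL2. \<Sum>(i, j)\<in>I. c i j * (A $ 1 $ 1) ^ i * (A $ 1 $ 2) ^ j | c I.
       finite I \<and> I \<subseteq> {(i, j). of_nat j \<le> h * of_nat i}}"

definition realizes_height ::
    "(nat \<Rightarrow> 'k::field) set \<Rightarrow> ('k^2^2 \<Rightarrow> (nat \<Rightarrow> 'k) \<Rightarrow> (nat \<Rightarrow> 'k)) \<Rightarrow>
     ('k^2^2 \<Rightarrow> (nat \<Rightarrow> 'k)) \<Rightarrow> rat \<Rightarrow> bool"
  where "realizes_height Y act \<phi> h \<longleftrightarrow>
    0 < h \<and> h \<le> 1 \<and> open_equivariant_embedding Y act \<phi> \<and>
    (\<lambda>f. compose SL2 f \<phi>) ` invariant_functions lower_unitriangular act Y = height_span h"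

text \<open>
  The action of the cyclic group on Y extending its action on SL(2) by right shifts. As the group is
  abelian, multiplication on the right by s is a left action.
\<close>

definition extends_right_shifts ::
    "nat \<Rightarrow> (nat \<Rightarrow> 'k::field) set \<Rightarrow> ('k^2^2 \<Rightarrow> (nat \<Rightarrow> 'k)) \<Rightarrow>
     ('k^2^2 \<Rightarrow> (nat \<Rightarrow> 'k) \<Rightarrow> (nat \<Rightarrow> 'k)) \<Rightarrow> bool"
  where "extends_right_shifts r Y \<phi> \<rho> \<longleftrightarrow>
    group_action (SL2_group\<lparr>carrier := Z_subgroup r\<rparr>) Y \<rho> \<and>
    (\<forall>s\<in>Z_subgroup r. morphism_on vec_coords Y vec_coords Y (\<rho> s)) \<and>
    (\<forall>s\<in>Z_subgroup r. \<forall>A\<in>SL2. \<rho> s (\<phi> A) = \<phi> (A ** s))"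

text \<open>
  X with the morphism from Y is the spectrum of the algebra of H-invariants of K[Y], and the
  morphism is SL(2)-equivariant: X is equivariantly isomorphic to Y//H.
\<close>

definition equivariant_quotient ::
    "'g set \<Rightarrow> ('g \<Rightarrow> (nat \<Rightarrow> 'k) \<Rightarrow> (nat \<Rightarrow> 'k)) \<Rightarrow>
     (nat \<Rightarrow> 'k) set \<Rightarrow> ('k^2^2 \<Rightarrow> (nat \<Rightarrow> 'k) \<Rightarrow> (nat \<Rightarrow> 'k)) \<Rightarrow>
     (nat \<Rightarrow> 'k::field) set \<Rightarrow> ('k^2^2 \<Rightarrow> (nat \<Rightarrow> 'k) \<Rightarrow> (nat \<Rightarrow> 'k)) \<Rightarrow>
     ((nat \<Rightarrow> 'k) \<Rightarrow> (nat \<Rightarrow> 'k)) \<Rightarrow> bool"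
  where "equivariant_quotient H \<rho> Y actY X actX \<pi> \<longleftrightarrow>
    morphism_on vec_coords Y vec_coords X \<pi> \<and>
    (\<forall>A\<in>SL2. \<forall>y\<in>Y. \<pi> (actY A y) = actX A (\<pi> y)) \<and>
    bij_betw (\<lambda>f. compose Y f \<pi>) (carrier (coord_ring X)) (invariant_functions H \<rho> Y)"

definition has_height ::
    "nat \<Rightarrow> (nat \<Rightarrow> 'k::field) set \<Rightarrow> ('k^2^2 \<Rightarrow> (nat \<Rightarrow> 'k) \<Rightarrow> (nat \<Rightarrow> 'k)) \<Rightarrow> rat \<Rightarrow> bool"
  where "has_height r X act h \<longleftrightarrow>
    (\<exists>Y actY \<phi> \<rho> \<pi>. SL2_mod_Z_embedding 1 Y actY \<and> realizes_height Y actY \<phi> h \<and>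
       extends_right_shifts r Y \<phi> \<rho> \<and>
       equivariant_quotient (Z_subgroup r) \<rho> Y actY X act \<pi>)"


section \<open>Cones and toric varieties\<close>

text \<open>
  The lattice N is the integer lattice in its rational span, and M = Hom(N, Z) is identified with
  the integer lattice by means of the dual basis.
\<close>

definition cone_generated :: "(rat^'n) set \<Rightarrow> (rat^'n) set"
  where "cone_generated S = {\<Sum>v\<in>S. c v *s v | c. \<forall>v\<in>S. 0 \<le> c v}"

definition strongly_convex_polyhedral_cone :: "(rat^'n) set \<Rightarrow> bool"
  where "strongly_convex_polyhedral_cone \<sigma> \<longleftrightarrow>
    (\<exists>S. finite S \<and> \<sigma> = cone_generated S) \<and> (\<forall>v. v \<in> \<sigma> \<and> - v \<in> \<sigma> \<longrightarrow> v = 0)"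

definition dual_cone :: "(rat^'n) set \<Rightarrow> (rat^'n::finite) set"
  where "dual_cone \<sigma> = {u. \<forall>v\<in>\<sigma>. 0 \<le> (\<Sum>i\<in>UNIV. u $ i * v $ i)}"

definition lattice_points :: "(rat^'n) set \<Rightarrow> (int^'n::finite) set"
  where "lattice_points \<tau> = {m. (\<chi> i. rat_of_int (m $ i)) \<in> \<tau>}"

text \<open>
  The semigroup algebra K[S] for a submonoid S of M, inside the group algebra K[M] of finitely
  supported functions on M with convolution product.
\<close>

definition semigroup_algebra :: "(int^'n::finite) set \<Rightarrow> ('k::field, (int^'n) \<Rightarrow>\<^sub>0 'k) module"
  where "semigroup_algebra S =
    \<lparr>carrier = {f. Poly_Mapping.keys f \<subseteq> S},
     monoid.mult = (*), one = 1, zero = 0, add = (+),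
     smult = (\<lambda>c f. Poly_Mapping.single 0 c * f)\<rparr>"

definition algebra_isomorphic :: "('k, 'a) module \<Rightarrow> ('k, 'b) module \<Rightarrow> bool"
  where "algebra_isomorphic A B \<longleftrightarrow>
    (\<exists>\<psi>\<in>ring_iso A B. \<forall>c. \<forall>x\<in>carrier A. \<psi> (c \<odot>\<^bsub>A\<^esub> x) = c \<odot>\<^bsub>B\<^esub> \<psi> x)"

definition toric_with_cone :: "(nat \<Rightarrow> 'k::field) set \<Rightarrow> (rat^'n::finite) set \<Rightarrow> bool"
  where "toric_with_cone X \<sigma> \<longleftrightarrow>
    strongly_convex_polyhedral_cone \<sigma> \<and>
    algebra_isomorphic (coord_ring X) (semigroup_algebra (lattice_points (dual_cone \<sigma>)))"

end

theory Submission
  imports Defs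
begin

text \<open>
  Write \<alpha>, \<beta>, \<gamma>, \<delta> for the matrix entries. Let B be the algebra K[Y] of the SL(2)-embedding Y of
  height p/q, pulled back to SL(2). As an SL(2)-module K[SL(2)] is the direct sum of the simple
  modules V(i, j) generated by the highest weight vectors \<alpha>^i \<beta>^j; the height says which of these
  vectors lie in B, so B is the sum of the V(i, j) with q j \<le> p i. The right action of the cyclic
  group of order r = l (q - p) has weight i - j on V(i, j), so the invariants are the sum of those
  V(i, j) with i - j = r m for some m, and then q j \<le> p i means j \<le> l p m and i \<le> l q m.
  On the other hand \<alpha> \<delta> - \<beta> \<gamma> = 1 shows that the functions bihomogeneous of degree l q m in \<alpha>, \<gamma> and
  l p m in \<beta>, \<delta> form the sum of the V(l q m - k, l p m - k). Hence K[X], the algebra of invariants,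
  has as basis the monomials \<alpha>^a \<gamma>^(l q m - a) \<beta>^b \<delta>^(l p m - b), which are multiplied by adding the
  exponents (a, b, m), and these exponents are the lattice points of the dual cone.
\<close>

section \<open>Roots of unity\<close>

text \<open>The height describes only the functions in B that are invariant under lower
  unitriangular matrices; passing from these to B is normally a matter of complete reducibility and
  highest weight theory. One elementary device replaces both: the translate of a polynomial function
  by a unipotent matrix is polynomial in the parameter c, and in characteristic zero the
  coefficients of a polynomial family lying in a subspace lie in it too. With upper unitriangular
  matrices this produces V(i, j) from \<alpha>^i \<beta>^j; with lower ones the leading coefficient
  is an invariant, which exposes any V(i, j) that the height forbids. The extreme bidegree (l q m, l
  p m) comes from substituting i = j + l (q - p) m into q j \<le> p i: the factor q - p cancels and
  leaves j \<le> l p m. It lies on the boundary line q j = p i, and lowering both entries by k keeps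
  it admissible because p < q.\<close>

lemma card_roots_of_unity:
  assumes "0 < r"
  shows "card {e :: 'k::{alg_closed_field, field_char_0}. e ^ r = 1} = r"
proof -
  define p where "p = Polynomial.monom (1::'k) r - 1"
  have deg: "Polynomial.degree p = r"
    using assms unfolding p_def
    by (metis degree_1 degree_add_eq_left degree_minus degree_monom_eq uminus_add_conv_diff
        add.commute zero_neq_one)
  have p0: "p \<noteq> 0"
    using deg assms by auto
  have roots: "{x. poly p x = 0} = {e. e ^ r = 1}"
    by (auto simp: p_def poly_monom)
  \<comment> \<open>A common zero of x^r - 1 and its derivative r x^(r-1) would be 0, which is not a
    root.\<close>
  have "rsquarefree p"
    unfolding rsquarefree_roots
    using assms by (auto simp: p_def poly_monom pderiv_monom pderiv_diff power_0_left)
  obtain A where A: "size A = Polynomial.degree p" "p = Polynomial.smult (lead_coeff p) (\<Prod>x\<in>#A. [:- x, 1:])"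
    using alg_closed_imp_factorization[OF p0] by blast
  have lc: "lead_coeff p \<noteq> 0"
    using p0 by simp
  have "poly (\<Prod>x\<in>#A. [:- x, 1:]) e = (\<Prod>x\<in>#A. e - x)" for e
    by (induction A) (auto simp: algebra_simps)
  then have zero: "poly p e = 0 \<longleftrightarrow> e \<in># A" for e
    using lc arg_cong[OF A(2), of "\<lambda>p. poly p e"] by (auto simp: prod_mset_zero_iff)
  \<comment> \<open>A repeated linear factor would be a double root. So the multiset of factors is a
    set, and its size, the degree r, counts the roots.\<close>
  have count: "count A a \<le> 1" for a
  proof (rule ccontr)
    assume "\<not> count A a \<le> 1"
    then have "{#a, a#} \<subseteq># A"
      by (auto simp: subseteq_mset_def)
    then obtain C where "A = {#a, a#} + C"
      by (auto simp: mset_subset_eq_exists_conv)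
    then have "p = [:- a, 1:] ^ 2 * Polynomial.smult (lead_coeff p) (\<Prod>x\<in>#C. [:- x, 1:])"
      using A(2) by (simp add: power2_eq_square mult_ac del: mult_pCons_left mult_pCons_right)
    then have "[:- a, 1:] ^ 2 dvd p"
      by (metis dvd_triv_left)
    then have "2 \<le> Polynomial.order a p"
      using p0 order_divides by blast
    then show False
      using \<open>rsquarefree p\<close> by (metis rsquarefree_def not_numeral_le_zero one_le_numeral
          numeral_le_one_iff semiring_norm(69))
  qed
  have "A = mset_set (set_mset A)"
  proof (rule multiset_eqI)
    fix a
    show "count A a = count (mset_set (set_mset A)) a"
      using count[of a] by (cases "a \<in># A") (auto simp: le_Suc_eq not_in_iff simp flip: count_greater_zero_iff)
  qed
  then have "size A = card (set_mset A)"
    by (metis size_mset_set)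
  moreover have "set_mset A = {e. e ^ r = 1}"
    using zero roots by auto
  ultimately show ?thesis
    using A(1) deg by simp
qed

text \<open>Orthogonality of characters of the cyclic group of order r. It makes averaging over the
  group a projection onto the weights divisible by r.\<close>

lemma sum_powers_roots_of_unity:
  assumes "0 < r"
  shows "(\<Sum>e | e ^ r = 1. e ^ k) = (if r dvd k then of_nat r else 0 :: 'k::{alg_closed_field, field_char_0})"
proof (cases "r dvd k")
  case True
  then have "(\<Sum>e | e ^ r = 1. e ^ k) = (\<Sum>e | e ^ r = (1::'k). (1::'k))"
    by (intro sum.cong) (auto simp: power_mult elim!: dvdE)
  then show ?thesis
    using True card_roots_of_unity[OF assms, where ?'k = 'k] by simp
next
  case False
  define g where "g = gcd r k"
  have g: "0 < g" "g < r"
  proof -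
    have "g dvd r" "g dvd k"
      by (simp_all add: g_def)
    then have "g \<noteq> r"
      using False by blast
    then show "g < r"
      using dvd_imp_le[OF \<open>g dvd r\<close> assms] by simp
    show "0 < g"
      using \<open>g dvd r\<close> assms by (auto intro: dvd_pos_nat)
  qed
  \<comment> \<open>If every r-th root of unity were killed by k as well, Bezout would make it a
    g-th root of unity, and there are only g < r of those.\<close>
  have "\<exists>z::'k. z ^ r = 1 \<and> z ^ k \<noteq> 1"
  proof (rule ccontr)
    assume no: "\<not> ?thesis"
    have "z ^ g = 1" if z: "z ^ r = 1" for z :: 'k
    proof -
      have "z ^ k = 1"
        using no z by blast
      obtain x y where "r * x = k * y + g"
        using bezout_nat[of r k] assms g_def by auto
      then have "(z ^ r) ^ x = (z ^ k) ^ y * z ^ g"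
        by (simp add: power_add flip: power_mult)
      then show ?thesis
        using z \<open>z ^ k = 1\<close> by simp
    qed
    then have "{e::'k. e ^ r = 1} \<subseteq> {e. e ^ g = 1}"
      by blast
    moreover have "finite {e::'k. e ^ g = 1}"
      using card_roots_of_unity[OF g(1), where ?'k = 'k] g(1) card_gt_0_iff by fastforce
    ultimately have "r \<le> g"
      by (metis card_mono card_roots_of_unity g(1) assms)
    then show False
      using g by simp
  qed
  then obtain z :: 'k where z: "z ^ r = 1" "z ^ k \<noteq> 1"
    by blast
  have "z \<noteq> 0"
    using z(1) assms by (metis power_0_left zero_neq_one less_not_refl)
  \<comment> \<open>Multiplication by z permutes the roots, so the sum equals itself times z^k,
    which is not 1.\<close>
  have "(\<Sum>e | e ^ r = 1. e ^ k) = (\<Sum>e | e ^ r = 1. (z * e) ^ k)"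
    using z \<open>z \<noteq> 0\<close>
    by (intro sum.reindex_bij_witness[of _ "\<lambda>e. z * e" "\<lambda>e. e / z"])
      (auto simp: power_mult_distrib power_divide)
  also have "\<dots> = z ^ k * (\<Sum>e | e ^ r = 1. e ^ k)"
    by (simp add: power_mult_distrib sum_distrib_left)
  finally show ?thesis
    using z(2) False by (simp add: mult_cancel_right2)
qed


section \<open>Linear combinations\<close>

text \<open>The coefficients form a finitely supported function, which is the type of the elements
  of \<open>semigroup_algebra\<close>; evaluating such an element in a family of functions is then
  \<open>lincomb\<close> itself.\<close>

definition lincomb :: "('i \<Rightarrow> 'a \<Rightarrow> 'k) \<Rightarrow> ('i \<Rightarrow>\<^sub>0 'k) \<Rightarrow> 'a \<Rightarrow> 'k::comm_ring_1" where
  "lincomb b \<kappa> x = (\<Sum>i\<in>Poly_Mapping.keys \<kappa>. Poly_Mapping.lookup \<kappa> i * b i x)"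

lemma lincomb_superset:
  assumes "finite I" "Poly_Mapping.keys \<kappa> \<subseteq> I"
  shows "lincomb b \<kappa> x = (\<Sum>i\<in>I. Poly_Mapping.lookup \<kappa> i * b i x)"
  unfolding lincomb_def using assms
  by (intro sum.mono_neutral_left) (auto simp: in_keys_iff)

lemma lincomb_zero [simp]: "lincomb b 0 x = 0"
  by (simp add: lincomb_def)

lemma lincomb_single [simp]: "lincomb b (Poly_Mapping.single i c) x = c * b i x"
  by (cases "c = 0") (simp_all add: lincomb_def)

lemma lincomb_add: "lincomb b (\<kappa> + \<mu>) x = lincomb b \<kappa> x + lincomb b \<mu> x"
proof -
  let ?I = "Poly_Mapping.keys \<kappa> \<union> Poly_Mapping.keys \<mu>"
  have "Poly_Mapping.keys (\<kappa> + \<mu>) \<subseteq> ?I"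
    by (rule Poly_Mapping.keys_add)
  then show ?thesis
    by (simp add: lincomb_superset[of ?I] lookup_add distrib_right sum.distrib)
qed

lemma lincomb_sum: "lincomb b (\<Sum>j\<in>J. \<kappa> j) x = (\<Sum>j\<in>J. lincomb b (\<kappa> j) x)"
  by (induction J rule: infinite_finite_induct) (simp_all add: lincomb_add)

lemma poly_mapping_sum_single:
  "\<kappa> = (\<Sum>i\<in>Poly_Mapping.keys \<kappa>. Poly_Mapping.single i (Poly_Mapping.lookup \<kappa> i))"
  by (rule poly_mapping_eqI)
    (simp add: lookup_sum lookup_single when_def in_keys_iff)

text \<open>Multiplicativity of \<open>b\<close> is demanded only on the keys because the toric
  monomials are multiplicative only inside the semigroup, where \<open>nat\<close> does not truncate
  their exponents.\<close>

lemma lincomb_mult: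
  fixes \<kappa> \<mu> :: "'i::comm_monoid_add \<Rightarrow>\<^sub>0 'k::comm_ring_1"
  assumes "\<And>i j. i \<in> Poly_Mapping.keys \<kappa> \<Longrightarrow> j \<in> Poly_Mapping.keys \<mu> \<Longrightarrow> b (i + j) x = b i x * b j x"
  shows "lincomb b (\<kappa> * \<mu>) x = lincomb b \<kappa> x * lincomb b \<mu> x"
proof -
  have "\<kappa> * \<mu> = (\<Sum>i\<in>Poly_Mapping.keys \<kappa>. \<Sum>j\<in>Poly_Mapping.keys \<mu>. Poly_Mapping.single (i + j)
      (Poly_Mapping.lookup \<kappa> i * Poly_Mapping.lookup \<mu> j))"
    by (subst (1) poly_mapping_sum_single[of \<kappa>], subst (1) poly_mapping_sum_single[of \<mu>])
      (simp add: sum_product mult_single)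
  then have "lincomb b (\<kappa> * \<mu>) x = (\<Sum>i\<in>Poly_Mapping.keys \<kappa>. \<Sum>j\<in>Poly_Mapping.keys \<mu>.
      Poly_Mapping.lookup \<kappa> i * Poly_Mapping.lookup \<mu> j * b (i + j) x)"
    by (simp add: lincomb_sum)
  also have "\<dots> = lincomb b \<kappa> x * lincomb b \<mu> x"
    unfolding lincomb_def sum_product by (intro sum.cong refl) (simp add: assms)
  finally show ?thesis .
qed

lemma poly_mapping_restrict:
  fixes \<kappa> :: "'i \<Rightarrow>\<^sub>0 'k::comm_monoid_add"
  obtains \<mu> \<nu> where "\<kappa> = \<mu> + \<nu>" "Poly_Mapping.keys \<mu> = Poly_Mapping.keys \<kappa> \<inter> I"
    "Poly_Mapping.keys \<nu> = Poly_Mapping.keys \<kappa> - I"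
proof -
  define res where "res J = (Abs_poly_mapping (\<lambda>i. if i \<in> J then Poly_Mapping.lookup \<kappa> i else 0))" for J
  have look: "Poly_Mapping.lookup (res J) i = (if i \<in> J then Poly_Mapping.lookup \<kappa> i else 0)" for J i
    unfolding res_def
    by (subst lookup_Abs_poly_mapping)
      (auto intro: finite_subset[OF _ finite_keys[of \<kappa>]] simp: in_keys_iff)
  have "\<kappa> = res I + res (- I)"
    by (rule poly_mapping_eqI) (simp add: look lookup_add)
  moreover have "Poly_Mapping.keys (res I) = Poly_Mapping.keys \<kappa> \<inter> I"
    "Poly_Mapping.keys (res (- I)) = Poly_Mapping.keys \<kappa> - I"
    by (auto simp: in_keys_iff look split: if_splits)
  ultimately show ?thesis
    by (rule that)
qed

text \<open>A polynomial vanishing off a finite set is zero, since the field is infinite. The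
  exceptional set \<open>S\<close> is there for parameter values that no matrix of determinant one
  realizes.\<close>

lemma separate_exponents:
  fixes g :: "'i \<Rightarrow> 'k::field_char_0"
  assumes "finite I" "finite S" "\<And>x. x \<notin> S \<Longrightarrow> (\<Sum>i\<in>I. g i * x ^ e i) = 0"
  shows "(\<Sum>i | i \<in> I \<and> e i = n. g i) = 0"
proof -
  define p where "p = (\<Sum>i\<in>I. Polynomial.monom (g i) (e i))"
  have "poly p x = 0" if "x \<notin> S" for x
    using assms(3)[OF that] by (simp add: p_def poly_sum poly_monom)
  then have "- S \<subseteq> {x. poly p x = 0}"
    by blast
  moreover have "infinite (- S)"
    using assms(2) by (metis finite_compl infinite_UNIV_char_0)
  ultimately have "p = 0"
    using poly_roots_finite finite_subset by blast
  then have "Polynomial.coeff p n = 0"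
    by simp
  then show ?thesis
    unfolding p_def coeff_sum using assms(1) by (simp add: sum.If_cases Int_def)
qed

text \<open>The values excluded for \<open>y\<close> may depend on \<open>x\<close>: below, the
  ratios of the entries in the two columns must differ.\<close>

lemma separate_two_exponents:
  fixes g :: "'i \<Rightarrow> 'k::field_char_0"
  assumes "finite I" "finite S" "\<And>x. x \<notin> S \<Longrightarrow> finite (T x)"
    and zero: "\<And>x y. x \<notin> S \<Longrightarrow> y \<notin> T x \<Longrightarrow> (\<Sum>i\<in>I. g i * x ^ d i * y ^ e i) = 0"
  shows "(\<Sum>i | i \<in> I \<and> d i = m \<and> e i = n. g i) = 0"
proof -
  have "(\<Sum>i\<in>{i. i \<in> I \<and> e i = n}. g i * x ^ d i) = 0" if "x \<notin> S" for x
    using separate_exponents[OF assms(1) assms(3)[OF that], of "\<lambda>i. g i * x ^ d i" e n] zero[OF that]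
    by simp
  from separate_exponents[OF _ assms(2) this, of m] show ?thesis
    using assms(1) by (simp add: conj_ac cong: conj_cong)
qed

section \<open>Subspaces of functions on SL(2)\<close>

text \<open>
  A function on SL(2) is represented by all its extensions to the space of matrices.
\<close>

definition SL2_subspace :: "('k::field^2^2 \<Rightarrow> 'k) set \<Rightarrow> bool" where
  "SL2_subspace V \<longleftrightarrow> (\<lambda>_. 0) \<in> V \<and>
    (\<forall>f\<in>V. \<forall>g\<in>V. (\<lambda>M. f M + g M) \<in> V) \<and> (\<forall>c. \<forall>f\<in>V. (\<lambda>M. c * f M) \<in> V) \<and>
    (\<forall>f\<in>V. \<forall>g. (\<forall>M\<in>SL2. f M = g M) \<longrightarrow> g \<in> V)"

lemma SL2_subspaceI:
  assumes "(\<lambda>_. 0) \<in> V" "\<And>f g. f \<in> V \<Longrightarrow> g \<in> V \<Longrightarrow> (\<lambda>M. f M + g M) \<in> V"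
    "\<And>c f. f \<in> V \<Longrightarrow> (\<lambda>M. c * f M) \<in> V" "\<And>f g. f \<in> V \<Longrightarrow> (\<And>M. M \<in> SL2 \<Longrightarrow> f M = g M) \<Longrightarrow> g \<in> V"
  shows "SL2_subspace V"
  using assms unfolding SL2_subspace_def by blast

lemma
  assumes "SL2_subspace V"
  shows SL2_subspace_0: "(\<lambda>_. 0) \<in> V"
    and SL2_subspace_add: "f \<in> V \<Longrightarrow> g \<in> V \<Longrightarrow> (\<lambda>M. f M + g M) \<in> V"
    and SL2_subspace_scale: "f \<in> V \<Longrightarrow> (\<lambda>M. c * f M) \<in> V"
    and SL2_subspace_cong: "f \<in> V \<Longrightarrow> (\<And>M. M \<in> SL2 \<Longrightarrow> f M = g M) \<Longrightarrow> g \<in> V"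
  using assms unfolding SL2_subspace_def by blast+

lemma SL2_subspace_diff:
  assumes "SL2_subspace V" "f \<in> V" "g \<in> V"
  shows "(\<lambda>M. f M - g M) \<in> V"
  using SL2_subspace_add[OF assms(1,2) SL2_subspace_scale[OF assms(1,3), of "-1"]] by simp

lemma SL2_subspace_sum:
  assumes "SL2_subspace V" "\<And>i. i \<in> I \<Longrightarrow> f i \<in> V"
  shows "(\<lambda>M. \<Sum>i\<in>I. f i M) \<in> V"
  using assms(2)
  by (induction I rule: infinite_finite_induct)
    (auto intro: SL2_subspace_0[OF assms(1)] SL2_subspace_add[OF assms(1)])

lemma SL2_subspace_lincomb:
  assumes "SL2_subspace V" "\<And>i. i \<in> Poly_Mapping.keys \<kappa> \<Longrightarrow> b i \<in> V"
  shows "lincomb b \<kappa> \<in> V"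
proof -
  have "lincomb b \<kappa> = (\<lambda>M. \<Sum>i\<in>Poly_Mapping.keys \<kappa>. Poly_Mapping.lookup \<kappa> i * b i M)"
    by (auto simp: lincomb_def)
  also have "\<dots> \<in> V"
    by (intro SL2_subspace_sum assms SL2_subspace_scale)
  finally show ?thesis .
qed

text \<open>A fixed factor is absorbed into the subspace. Inductions with \<open>V\<close> arbitrary
  can thus strip off one matrix entry at a time.\<close>

lemma SL2_subspace_factor:
  assumes "SL2_subspace V"
  shows "SL2_subspace {f. (\<lambda>M. h M * f M) \<in> V}"
proof (rule SL2_subspaceI; clarsimp)
  show "(\<lambda>M. 0) \<in> V"
    by (rule SL2_subspace_0[OF assms])
next
  fix f g assume "(\<lambda>M. h M * f M) \<in> V" "(\<lambda>M. h M * g M) \<in> V"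
  then show "(\<lambda>M. h M * (f M + g M)) \<in> V"
    using SL2_subspace_add[OF assms] by (fastforce simp: distrib_left)
next
  fix c f assume "(\<lambda>M. h M * f M) \<in> V"
  then show "(\<lambda>M. h M * (c * f M)) \<in> V"
    using SL2_subspace_scale[OF assms, of _ c] by (fastforce simp: mult.left_commute)
next
  fix f g assume "(\<lambda>M. h M * f M) \<in> V" "\<And>M. M \<in> SL2 \<Longrightarrow> f M = g M"
  then show "(\<lambda>M. h M * g M) \<in> V"
    using SL2_subspace_cong[OF assms] by fastforce
qed

text \<open>Spans are subspaces of this kind, so a membership proved for every
  \<open>SL2_subspace\<close> specializes to an explicit expansion.\<close>

lemma SL2_subspace_lincombs:
  fixes b :: "'i \<Rightarrow> 'k::field^2^2 \<Rightarrow> 'k"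
  shows "SL2_subspace {f. \<exists>\<kappa>. Poly_Mapping.keys \<kappa> \<subseteq> I \<and> (\<forall>M\<in>SL2. f M = lincomb b \<kappa> M)}"
proof (rule SL2_subspaceI; clarify?)
  show "\<exists>\<kappa>. Poly_Mapping.keys \<kappa> \<subseteq> I \<and> (\<forall>M\<in>SL2. 0 = lincomb b \<kappa> M)"
    by (intro exI[of _ 0]) simp
next
  fix f g \<kappa> \<mu>
  assume "Poly_Mapping.keys \<kappa> \<subseteq> I" "\<forall>M\<in>SL2. f M = lincomb b \<kappa> M"
    "Poly_Mapping.keys \<mu> \<subseteq> I" "\<forall>M\<in>SL2. g M = lincomb b \<mu> M"
  then show "\<exists>\<kappa>. Poly_Mapping.keys \<kappa> \<subseteq> I \<and> (\<forall>M\<in>SL2. f M + g M = lincomb b \<kappa> M)"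
    using Poly_Mapping.keys_add[of \<kappa> \<mu>] by (intro exI[of _ "\<kappa> + \<mu>"]) (auto simp: lincomb_add)
next
  fix c f \<kappa>
  assume *: "Poly_Mapping.keys \<kappa> \<subseteq> I" "\<forall>M\<in>SL2. f M = lincomb b \<kappa> M"
  let ?\<mu> = "Poly_Mapping.map ((*) c) \<kappa>"
  have look: "Poly_Mapping.lookup ?\<mu> i = c * Poly_Mapping.lookup \<kappa> i" for i
    by (simp add: map.rep_eq when_def)
  then have sub: "Poly_Mapping.keys ?\<mu> \<subseteq> Poly_Mapping.keys \<kappa>"
    by (auto simp: in_keys_iff)
  then have "c * lincomb b \<kappa> M = lincomb b ?\<mu> M" for M
    unfolding lincomb_superset[OF finite_keys sub]
    by (simp add: look lincomb_def sum_distrib_left mult.assoc)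
  then show "\<exists>\<kappa>. Poly_Mapping.keys \<kappa> \<subseteq> I \<and> (\<forall>M\<in>SL2. c * f M = lincomb b \<kappa> M)"
    using * sub by (intro exI[of _ ?\<mu>]) auto
qed auto

text \<open>Subtracting the value at 2 c from 2^(d+1) times the value at c eliminates the top
  coefficient and multiplies the k-th one by 2^(d+1) - 2^k, which is nonzero in characteristic zero.
  This takes the place of a Vandermonde determinant.\<close>

lemma SL2_subspace_coefficients:
  fixes g :: "nat \<Rightarrow> 'k::field_char_0^2^2 \<Rightarrow> 'k"
  assumes V: "SL2_subspace V" and "\<And>c. (\<lambda>M. \<Sum>k\<le>d. c ^ k * g k M) \<in> V" and "k \<le> d"
  shows "g k \<in> V"
  using assms(2,3)
proof (induction d arbitrary: g k)
  case 0
  then show ?case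
    using "0.prems"(1)[of 1] by simp
next
  case (Suc d)
  have low: "g k \<in> V" if "k \<le> d" for k
  proof -
    define h where "h k M = (2 ^ Suc d - 2 ^ k) * g k M" for k and M :: "'k^2^2"
    have "(\<lambda>M. \<Sum>k\<le>d. c ^ k * h k M) \<in> V" for c
    proof -
      have "(\<lambda>M. 2 ^ Suc d * (\<Sum>k\<le>Suc d. c ^ k * g k M) - (\<Sum>k\<le>Suc d. (2 * c) ^ k * g k M)) \<in> V"
        by (intro SL2_subspace_diff SL2_subspace_scale V Suc.prems)
      also have "(\<lambda>M. 2 ^ Suc d * (\<Sum>k\<le>Suc d. c ^ k * g k M) - (\<Sum>k\<le>Suc d. (2 * c) ^ k * g k M)) =
        (\<lambda>M. \<Sum>k\<le>d. c ^ k * h k M)"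
        by (intro ext) (simp add: h_def sum_distrib_left power_mult_distrib algebra_simps
            flip: sum_subtractf)
      finally show ?thesis .
    qed
    then have "h k \<in> V"
      using Suc.IH that by blast
    moreover have "(2::'k) ^ Suc d - 2 ^ k \<noteq> 0"
    proof -
      have "(2::nat) ^ Suc d \<noteq> 2 ^ k"
        using that power_inject_exp[of "2::nat" "Suc d" k] by auto
      then have "of_nat (2 ^ Suc d) \<noteq> (of_nat (2 ^ k) :: 'k)"
        by (simp only: of_nat_eq_iff not_False_eq_True)
      then show ?thesis
        by simp
    qed
    ultimately show ?thesis
      using SL2_subspace_scale[OF V, of "h k" "inverse (2 ^ Suc d - 2 ^ k)"]
      unfolding h_def by (simp flip: mult.assoc)
  qed
  have "(\<lambda>M. (\<Sum>k\<le>Suc d. 1 ^ k * g k M) - (\<Sum>k\<le>d. g k M)) \<in> V"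
    by (intro SL2_subspace_diff SL2_subspace_sum V Suc.prems low) auto
  then have "g (Suc d) \<in> V"
    by simp
  with low Suc.prems(2) show ?case
    by (cases "k = Suc d") auto
qed


section \<open>Ladders of weight vectors\<close>

text \<open>
  The coefficients of (\<alpha> + \<gamma> e)^A (\<beta> + \<delta> e)^B as a polynomial in e form a basis of
  the simple SL(2)-module generated by \<alpha>^A \<beta>^B.
\<close>

definition ladder :: "nat \<Rightarrow> nat \<Rightarrow> nat \<Rightarrow> 'k::field^2^2 \<Rightarrow> 'k" where
  "ladder A B t M = Polynomial.coeff ([:M$1$1, M$2$1:] ^ A * [:M$1$2, M$2$2:] ^ B) t"

lemma degree_ladder: "Polynomial.degree ([:a, c:] ^ A * [:b, d:] ^ B) \<le> A + B"
  for a :: "'k::field"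
  by (rule order.trans[OF degree_mult_le add_mono]; rule order.trans[OF degree_power_le])
    (simp_all add: degree_pCons_eq_if)

lemma ladder_beyond: "A + B < t \<Longrightarrow> ladder A B t M = 0"
  unfolding ladder_def using degree_ladder by (intro coeff_eq_0) (rule le_less_trans)

lemma ladder_zero [simp]: "ladder A B 0 M = (M$1$1) ^ A * (M$1$2) ^ B"
  by (simp add: ladder_def coeff_mult coeff_0_power)

lemma coeff_linear_mult:
  "Polynomial.coeff ([:a, b:] * P) t =
    a * Polynomial.coeff P t + b * (if t = 0 then 0 else Polynomial.coeff P (t - 1))"
  by (cases t) simp_all

lemma ladder_Suc_left:
  "ladder (Suc A) B t M = M$1$1 * ladder A B t M + M$2$1 * (if t = 0 then 0 else ladder A B (t - 1) M)"
  by (simp only: ladder_def power_Suc mult.assoc coeff_linear_mult)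

lemma ladder_Suc_right:
  "ladder A (Suc B) t M = M$1$2 * ladder A B t M + M$2$2 * (if t = 0 then 0 else ladder A B (t - 1) M)"
  by (simp only: ladder_def power_Suc mult.left_commute[of "[:_, _:] ^ A"] coeff_linear_mult)

text \<open>The right-hand side is the translate of \<alpha>^A \<beta>^B by the upper unitriangular
  matrix with parameter \<open>c\<close>; the ladder consists of the coefficients of these
  translates.\<close>

lemma ladder_generating:
  "(\<Sum>t\<le>A + B. c ^ t * ladder A B t M) = (M$1$1 + c * M$2$1) ^ A * (M$1$2 + c * M$2$2) ^ B"
proof -
  let ?P = "[:M$1$1, M$2$1:] ^ A * [:M$1$2, M$2$2:] ^ B"
  have "poly ?P c = (\<Sum>t\<le>A + B. Polynomial.coeff ?P t * c ^ t)"
    unfolding poly_altdef using degree_ladder by (intro sum.mono_neutral_left) (auto simp: coeff_eq_0)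
  then show ?thesis
    by (simp add: ladder_def mult.commute)
qed

section \<open>Ladders under left translation by lower unitriangular matrices\<close>

lemma matrix_mult_2:
  "(A ** B) $ i $ j = A$i$1 * B$1$j + A$i$2 * B$2$j" for A :: "'k::semiring_1^2^'n"
  by (simp add: matrix_matrix_mult_def sum_2)

definition lower :: "'k::field \<Rightarrow> 'k^2^2" where
  "lower c = vector [vector [1, 0], vector [c, 1]]"

text \<open>Homogenization is taken with respect to the formal degree \<open>N\<close>, which may
  exceed the actual one; this makes it multiplicative even where entries of the matrix
  vanish.\<close>

lemma homogenization_pCons:
  fixes P :: "'k::field poly" and x y :: "'k poly"
  assumes "Polynomial.degree P \<le> N"
  shows "(\<Sum>s\<le>Suc N. [:Polynomial.coeff ([:a, b:] * P) s:] * x ^ (Suc N - s) * y ^ s) =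
    ([:a:] * x + [:b:] * y) * (\<Sum>s\<le>N. [:Polynomial.coeff P s:] * x ^ (N - s) * y ^ s)"
proof -
  have "(\<Sum>s\<le>Suc N. [:Polynomial.coeff ([:a, b:] * P) s:] * x ^ (Suc N - s) * y ^ s) =
    (\<Sum>s\<le>Suc N. [:a * Polynomial.coeff P s:] * x ^ (Suc N - s) * y ^ s) +
    (\<Sum>s\<le>Suc N. [:b * (if s = 0 then 0 else Polynomial.coeff P (s - 1)):] * x ^ (Suc N - s) * y ^ s)"
    by (simp only: coeff_linear_mult sum.distrib[symmetric] distrib_right[symmetric] add_pCons add_0_left)
  also have "(\<Sum>s\<le>Suc N. [:a * Polynomial.coeff P s:] * x ^ (Suc N - s) * y ^ s) =
    [:a:] * x * (\<Sum>s\<le>N. [:Polynomial.coeff P s:] * x ^ (N - s) * y ^ s)"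
    using assms by (simp add: coeff_eq_0 sum_distrib_left Suc_diff_le mult_ac)
  also have "(\<Sum>s\<le>Suc N. [:b * (if s = 0 then 0 else Polynomial.coeff P (s - 1)):] * x ^ (Suc N - s) * y ^ s) =
    [:b:] * y * (\<Sum>s\<le>N. [:Polynomial.coeff P s:] * x ^ (N - s) * y ^ s)"
    by (simp only: sum.atMost_Suc_shift) (simp add: sum_distrib_left mult_ac)
  finally show ?thesis
    by (simp add: distrib_right)
qed

text \<open>The variables \<open>x\<close> and \<open>y\<close> are themselves polynomials in e,
  because 1 + c e and e are going to be substituted for them.\<close>

lemma homogenization_ladder:
  fixes x y :: "'k::field poly"
  shows "(\<Sum>s\<le>A + B. [:ladder A B s M:] * x ^ (A + B - s) * y ^ s) =
    ([:M$1$1:] * x + [:M$2$1:] * y) ^ A * ([:M$1$2:] * x + [:M$2$2:] * y) ^ B"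
proof (induction A)
  case 0
  show ?case
  proof (induction B)
    case 0
    show ?case by simp
  next
    case (Suc B)
    have "Polynomial.degree ([:M$1$2, M$2$2:] ^ B) \<le> B"
      using degree_ladder[of 1 0 0] by simp
    from homogenization_pCons[OF this, of "M$1$2" "M$2$2" x y] show ?case
      using Suc.IH by (simp only: ladder_def add_0_left power_0 mult_1_left power_Suc)
  qed
next
  case (Suc A)
  from homogenization_pCons[OF degree_ladder, of "M$1$1" "M$2$1" "M$1$1" "M$2$1" A "M$1$2" "M$2$2" B x y]
  show ?case
    using Suc.IH by (simp only: ladder_def add_Suc power_Suc mult.assoc)
qed

text \<open>Translation by \<open>lower c\<close> turns \<alpha> + \<gamma> e into \<alpha> (1 + c
  e) + \<gamma> e, and likewise for \<beta>, \<delta>: it substitutes 1 + c e and e into the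
  homogenized generating polynomial. The highest power of c sits at s = 0, on the highest weight
  vector \<alpha>^A \<beta>^B.\<close>

lemma ladder_lower:
  fixes M :: "'k::field^2^2"
  assumes "t \<le> A + B"
  shows "ladder A B t (lower c ** M) =
    (\<Sum>s\<le>t. of_nat (A + B - s choose (t - s)) * c ^ (t - s) * ladder A B s M)"
proof -
  have monom: "[:a:] * P * [:0, 1:] ^ s = Polynomial.monom a s * P" for a :: 'k and P s
    by (simp add: monom_altdef mult.commute)
  have "ladder A B t (lower c ** M) = Polynomial.coeff
      (([:M$1$1:] * [:1, c:] + [:M$2$1:] * [:0, 1:]) ^ A *
       ([:M$1$2:] * [:1, c:] + [:M$2$2:] * [:0, 1:]) ^ B) t"
    by (simp add: ladder_def matrix_mult_2 lower_def mult.commute)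
  also have "\<dots> = (\<Sum>s\<le>A + B. Polynomial.coeff ([:ladder A B s M:] * [:1, c:] ^ (A + B - s) * [:0, 1:] ^ s) t)"
    by (simp only: homogenization_ladder[symmetric] coeff_sum)
  also have "\<dots> = (\<Sum>s\<le>A + B. if s \<le> t
      then ladder A B s M * (of_nat (A + B - s choose (t - s)) * c ^ (t - s)) else 0)"
    using assms
    unfolding monom by (intro sum.cong refl) (auto simp: coeff_linear_poly_power coeff_monom_mult)
  also have "\<dots> = (\<Sum>s\<le>t. of_nat (A + B - s choose (t - s)) * c ^ (t - s) * ladder A B s M)"
    using assms by (simp add: sum.If_cases Int_absorb1 atMost_def Collect_mono_iff mult_ac flip: atMost_def)
  finally show ?thesis .
qed

section \<open>Products of ladders with matrix entries (Clebsch-Gordan rule)\<close>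

lemma ladder_Suc_coefficient:
  "of_nat (t + 1) * ladder A B (t + 1) M =
    of_nat A * M$2$1 * ladder (A - 1) B t M + of_nat B * M$2$2 * ladder A (B - 1) t M"
  for M :: "'k::field_char_0^2^2"
proof -
  let ?L = "[:M$1$1, M$2$1:]" and ?R = "[:M$1$2, M$2$2:]"
  have deriv: "pderiv ([:a, b:] ^ n) = Polynomial.smult (of_nat n * b) ([:a, b:] ^ (n - 1))" for a b :: 'k and n
    by (simp add: pderiv_power pderiv_pCons mult.commute)
  \<comment> \<open>The formula compares coefficients in the derivative with respect to e. For A = 0
    or B = 0 the truncated exponent is harmless, as its factor vanishes.\<close>
  have "pderiv (?L ^ A * ?R ^ B) = Polynomial.smult (of_nat A * M$2$1) (?L ^ (A - 1) * ?R ^ B) +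
      Polynomial.smult (of_nat B * M$2$2) (?L ^ A * ?R ^ (B - 1))"
    unfolding pderiv_mult deriv by (simp only: mult_smult_left mult_smult_right add.commute mult.commute)
  from arg_cong[OF this, of "\<lambda>p. Polynomial.coeff p t"] show ?thesis
    by (simp only: coeff_pderiv ladder_def coeff_add coeff_smult Suc_eq_plus1)
qed

text \<open>For generating polynomials this reads \<delta> (\<alpha> + \<gamma> e) = 1 + \<gamma>
  (\<beta> + \<delta> e).\<close>

lemma ladder_det:
  assumes "M \<in> SL2"
  shows "M$2$2 * ladder (A + 1) B t M = ladder A B t M + M$2$1 * ladder A (B + 1) t M"
proof -
  have "M$1$1 * M$2$2 = 1 + M$1$2 * M$2$1"
    using assms by (simp add: SL2_def det_2 algebra_simps)
  then have "(M$1$1 * M$2$2) * x = (1 + M$1$2 * M$2$1) * x" for x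
    by simp
  from this[of "ladder A B t M"] show ?thesis
    by (simp add: ladder_Suc_left ladder_Suc_right algebra_simps)
qed

text \<open>The derivative formula for (A + 1, B) contains a \<gamma>-product and a
  \<delta>-product; \<open>ladder_det\<close> converts the latter into the former. So multiplication
  by \<gamma> leads only to the neighbours (A + 1, B) and (A, B - 1).\<close>

lemma ladder_mult_lower_left:
  fixes M :: "'k::field_char_0^2^2"
  assumes "M \<in> SL2"
  shows "of_nat (A + B + 1) * (M$2$1 * ladder A B t M) =
    of_nat (t + 1) * ladder (A + 1) B (t + 1) M - of_nat B * ladder A (B - 1) t M"
proof (cases B)
  case 0
  then show ?thesis
    using ladder_Suc_coefficient[of t "A + 1" B M] by simp
next
  case (Suc C)
  have "of_nat B * M$2$2 * ladder (A + 1) C t M = of_nat B * (ladder A C t M + M$2$1 * ladder A B t M)"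
    using ladder_det[OF assms, of A C t] by (simp add: Suc mult.assoc)
  then show ?thesis
    using ladder_Suc_coefficient[of t "A + 1" B M] by (simp add: Suc algebra_simps)
qed

lemma ladder_mult_lower_right:
  fixes M :: "'k::field_char_0^2^2"
  assumes "M \<in> SL2"
  shows "of_nat (A + B + 1) * (M$2$2 * ladder A B t M) =
    of_nat (t + 1) * ladder A (B + 1) (t + 1) M + of_nat A * ladder (A - 1) B t M"
proof (cases A)
  case 0
  then show ?thesis
    using ladder_Suc_coefficient[of t A "B + 1" M] by simp
next
  case (Suc C)
  have "of_nat A * M$2$1 * ladder C (B + 1) t M = of_nat A * (M$2$2 * ladder A B t M - ladder C B t M)"
    using ladder_det[OF assms, of C B t] by (simp add: Suc mult.assoc)
  then show ?thesis
    using ladder_Suc_coefficient[of t A "B + 1" M] by (simp add: Suc algebra_simps)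
qed

lemma SL2_subspace_ladder_mult_left:
  fixes V :: "('k::field_char_0^2^2 \<Rightarrow> 'k) set"
  assumes V: "SL2_subspace V" and up: "\<And>t. ladder (A + 1) B t \<in> V"
    and down: "\<And>t. 0 < B \<Longrightarrow> ladder A (B - 1) t \<in> V"
  shows "(\<lambda>M. M$2$1 * ladder A B t M) \<in> V" "(\<lambda>M. M$1$1 * ladder A B t M) \<in> V"
proof -
  have cancel: "inverse (of_nat (A + B + 1)) * (of_nat (A + B + 1) * x) = x" for x :: 'k
    by (simp flip: mult.assoc del: of_nat_add of_nat_Suc)
  show lower: "(\<lambda>M. M$2$1 * ladder A B t M) \<in> V" for t
  proof -
    have "(\<lambda>M. inverse (of_nat (A + B + 1)) *
        (of_nat (t + 1) * ladder (A + 1) B (t + 1) M - of_nat B * ladder A (B - 1) t M)) \<in> V"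
    proof (cases "B = 0")
      case True
      then show ?thesis
        using SL2_subspace_scale[OF V SL2_subspace_scale[OF V up]] by simp
    next
      case False
      then show ?thesis
        by (intro SL2_subspace_scale[OF V] SL2_subspace_diff[OF V] up down) simp
    qed
    then show ?thesis
      by (rule SL2_subspace_cong[OF V])
        (simp only: ladder_mult_lower_left[symmetric] cancel)
  qed
  \<comment> \<open>The recursion for \<open>ladder (A + 1) B t\<close> expresses the
    \<alpha>-product by the \<gamma>-product one rung lower; on the bottom rung only the
    \<alpha>-product is present.\<close>
  show "(\<lambda>M. M$1$1 * ladder A B t M) \<in> V"
  proof (cases t)
    case 0
    have "(\<lambda>M. M$1$1 * ladder A B 0 M) = ladder (A + 1) B 0"
      by (simp add: fun_eq_iff mult.assoc)
    with up[of 0] show ?thesis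
      by (metis 0)
  next
    case (Suc s)
    have "(\<lambda>M. ladder (A + 1) B t M - M$2$1 * ladder A B s M) \<in> V"
      by (intro SL2_subspace_diff[OF V] up lower)
    then show ?thesis
      by (simp add: Suc ladder_Suc_left)
  qed
qed

lemma SL2_subspace_ladder_mult_right:
  fixes V :: "('k::field_char_0^2^2 \<Rightarrow> 'k) set"
  assumes V: "SL2_subspace V" and up: "\<And>t. ladder A (B + 1) t \<in> V"
    and down: "\<And>t. 0 < A \<Longrightarrow> ladder (A - 1) B t \<in> V"
  shows "(\<lambda>M. M$2$2 * ladder A B t M) \<in> V" "(\<lambda>M. M$1$2 * ladder A B t M) \<in> V"
proof -
  have cancel: "inverse (of_nat (A + B + 1)) * (of_nat (A + B + 1) * x) = x" for x :: 'k
    by (simp flip: mult.assoc del: of_nat_add of_nat_Suc)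
  show lower: "(\<lambda>M. M$2$2 * ladder A B t M) \<in> V" for t
  proof -
    have "(\<lambda>M. inverse (of_nat (A + B + 1)) *
        (of_nat (t + 1) * ladder A (B + 1) (t + 1) M + of_nat A * ladder (A - 1) B t M)) \<in> V"
    proof (cases "A = 0")
      case True
      then show ?thesis
        using SL2_subspace_scale[OF V SL2_subspace_scale[OF V up]] by simp
    next
      case False
      then show ?thesis
        by (intro SL2_subspace_scale[OF V] SL2_subspace_add[OF V] up down) simp
    qed
    then show ?thesis
      by (rule SL2_subspace_cong[OF V])
        (simp only: ladder_mult_lower_right[symmetric] cancel)
  qed
  show "(\<lambda>M. M$1$2 * ladder A B t M) \<in> V"
  proof (cases t)
    case 0
    have "(\<lambda>M. M$1$2 * ladder A B 0 M) = ladder A (B + 1) 0"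
      by (simp add: fun_eq_iff mult.left_commute)
    with up[of 0] show ?thesis
      by (metis 0)
  next
    case (Suc s)
    have "(\<lambda>M. ladder A (B + 1) t M - M$2$2 * ladder A B s M) \<in> V"
      by (intro SL2_subspace_diff[OF V] up lower)
    then show ?thesis
      by (simp add: Suc ladder_Suc_right)
  qed
qed

section \<open>Monomials in the matrix entries, graded by their degrees in the two columns\<close>

definition entry_monomial :: "nat \<Rightarrow> nat \<Rightarrow> nat \<Rightarrow> nat \<Rightarrow> 'k::field^2^2 \<Rightarrow> 'k" where
  "entry_monomial a c b d M = (M$1$1) ^ a * (M$2$1) ^ c * (M$1$2) ^ b * (M$2$2) ^ d"

lemma entry_monomial_Suc:
  "entry_monomial (Suc a) c b d = (\<lambda>M. M$1$1 * entry_monomial a c b d M)"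
  "entry_monomial a (Suc c) b d = (\<lambda>M. M$2$1 * entry_monomial a c b d M)"
  "entry_monomial a c (Suc b) d = (\<lambda>M. M$1$2 * entry_monomial a c b d M)"
  "entry_monomial a c b (Suc d) = (\<lambda>M. M$2$2 * entry_monomial a c b d M)"
  by (auto simp: entry_monomial_def mult_ac)

text \<open>Each further entry either raises the degree of its own column or lowers that of the
  other one. Starting from constants, bidegree (m, n) therefore meets only the ladders (m - k, n -
  k).\<close>

lemma entry_monomial_in_ladder_span:
  fixes V :: "('k::field_char_0^2^2 \<Rightarrow> 'k) set"
  assumes "SL2_subspace V"
    and "\<And>k t. k \<le> a + c \<Longrightarrow> k \<le> b + d \<Longrightarrow> ladder (a + c - k) (b + d - k) t \<in> V"
  shows "entry_monomial a c b d \<in> V"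
  using assms
proof (induction "a + c + b + d" arbitrary: a b c d V)
  case 0
  then show ?case
    using "0.prems"(2)[of 0 0] by (auto simp: entry_monomial_def[abs_def])
next
  case (Suc n)
  note V = Suc.prems(1)
  have left: "(\<lambda>M. h M * entry_monomial a' c' b d M) \<in> V"
    if h: "h = (\<lambda>M. M$2$1) \<or> h = (\<lambda>M. M$1$1)" and "a + c = Suc (a' + c')"
    for a' c' and h :: "'k^2^2 \<Rightarrow> 'k"
  proof -
    have "ladder (a' + c' - k) (b + d - k) t \<in> {f. (\<lambda>M. h M * f M) \<in> V}"
      if "k \<le> a' + c'" "k \<le> b + d" for k t
    proof -
      have "ladder (a' + c' - k + 1) (b + d - k) t \<in> V" for t
        using Suc.prems(2)[of k t] that \<open>a + c = _\<close> by (simp add: Suc_diff_le)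
      \<comment> \<open>The lower neighbour is the ladder with k + 1 in place of k for the larger
        monomial.\<close>
      moreover have "ladder (a' + c' - k) (b + d - k - 1) t \<in> V" if "0 < b + d - k" for t
        using Suc.prems(2)[of "k + 1" t] that \<open>k \<le> a' + c'\<close> \<open>a + c = _\<close> by simp
      ultimately show ?thesis
        using SL2_subspace_ladder_mult_left[OF V, of "a' + c' - k" "b + d - k"] h by blast
    qed
    with Suc.hyps(1)[of a' c' b d, OF _ SL2_subspace_factor[OF V]] show ?thesis
      using Suc.hyps(2) \<open>a + c = _\<close> by simp
  qed
  have right: "(\<lambda>M. h M * entry_monomial a c b' d' M) \<in> V"
    if h: "h = (\<lambda>M. M$2$2) \<or> h = (\<lambda>M. M$1$2)" and "b + d = Suc (b' + d')"
    for b' d' and h :: "'k^2^2 \<Rightarrow> 'k"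
  proof -
    have "ladder (a + c - k) (b' + d' - k) t \<in> {f. (\<lambda>M. h M * f M) \<in> V}"
      if "k \<le> a + c" "k \<le> b' + d'" for k t
    proof -
      have "ladder (a + c - k) (b' + d' - k + 1) t \<in> V" for t
        using Suc.prems(2)[of k t] that \<open>b + d = _\<close> by (simp add: Suc_diff_le)
      moreover have "ladder (a + c - k - 1) (b' + d' - k) t \<in> V" if "0 < a + c - k" for t
        using Suc.prems(2)[of "k + 1" t] that \<open>k \<le> b' + d'\<close> \<open>b + d = _\<close> by simp
      ultimately show ?thesis
        using SL2_subspace_ladder_mult_right[OF V, of "a + c - k" "b' + d' - k"] h by blast
    qed
    with Suc.hyps(1)[of a c b' d', OF _ SL2_subspace_factor[OF V]] show ?thesis
      using Suc.hyps(2) \<open>b + d = _\<close> by simp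
  qed
  consider a' where "a = Suc a'" | c' where "c = Suc c'" | b' where "b = Suc b'" | d' where "d = Suc d'"
    using Suc.hyps(2) by (cases a; cases c; cases b; cases d) auto
  then show ?case
    by cases (auto simp: entry_monomial_Suc intro!: left right)
qed

lemma ladder_in_monomial_span:
  assumes "SL2_subspace V" "\<And>a c b d. a + c = A \<Longrightarrow> b + d = B \<Longrightarrow> entry_monomial a c b d \<in> V"
  shows "ladder A B t \<in> V"
  using assms
proof (induction "A + B" arbitrary: A B t V)
  case 0
  have "ladder 0 0 t = (\<lambda>M. (if t = 0 then 1 else 0) * entry_monomial 0 0 0 0 M)"
    by (auto simp: ladder_def entry_monomial_def)
  also have "\<dots> \<in> V"
    using 0 by (intro SL2_subspace_scale) auto
  finally show ?case
    using 0 by simp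
next
  case (Suc n)
  note V = Suc.prems(1)
  show ?case
  proof (cases A)
    case (Suc A')
    have "(\<lambda>M. M$1$1 * ladder A' B t M) \<in> V" for t
      using Suc.hyps(1)[of A' B "{f. (\<lambda>M. M$1$1 * f M) \<in> V}", OF _ SL2_subspace_factor[OF V]]
        Suc.hyps(2) Suc.prems(2) by (simp add: Suc flip: entry_monomial_Suc)
    moreover have "(\<lambda>M. M$2$1 * ladder A' B t M) \<in> V" for t
      using Suc.hyps(1)[of A' B "{f. (\<lambda>M. M$2$1 * f M) \<in> V}", OF _ SL2_subspace_factor[OF V]]
        Suc.hyps(2) Suc.prems(2) by (simp add: Suc flip: entry_monomial_Suc)
    ultimately have "(\<lambda>M. M$1$1 * ladder A' B t M + (if t = 0 then 0 else 1) * (M$2$1 * ladder A' B (t - 1) M)) \<in> V"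
      by (intro SL2_subspace_add[OF V] SL2_subspace_scale[OF V])
    also have "(\<lambda>M. M$1$1 * ladder A' B t M + (if t = 0 then 0 else 1) * (M$2$1 * ladder A' B (t - 1) M)) =
        ladder A B t"
      by (auto simp: Suc ladder_Suc_left)
    finally show ?thesis .
  next
    case 0
    then obtain B' where B: "B = Suc B'"
      using Suc.hyps(2) by (cases B) auto
    have "(\<lambda>M. M$1$2 * ladder A B' t M) \<in> V" for t
      using Suc.hyps(1)[of A B' "{f. (\<lambda>M. M$1$2 * f M) \<in> V}", OF _ SL2_subspace_factor[OF V]]
        Suc.hyps(2) Suc.prems(2) by (simp add: B flip: entry_monomial_Suc)
    moreover have "(\<lambda>M. M$2$2 * ladder A B' t M) \<in> V" for t
      using Suc.hyps(1)[of A B' "{f. (\<lambda>M. M$2$2 * f M) \<in> V}", OF _ SL2_subspace_factor[OF V]]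
        Suc.hyps(2) Suc.prems(2) by (simp add: B flip: entry_monomial_Suc)
    ultimately have "(\<lambda>M. M$1$2 * ladder A B' t M + (if t = 0 then 0 else 1) * (M$2$2 * ladder A B' (t - 1) M)) \<in> V"
      by (intro SL2_subspace_add[OF V] SL2_subspace_scale[OF V])
    also have "(\<lambda>M. M$1$2 * ladder A B' t M + (if t = 0 then 0 else 1) * (M$2$2 * ladder A B' (t - 1) M)) =
        ladder A B t"
      by (auto simp: B ladder_Suc_right)
    finally show ?thesis .
  qed
qed

text \<open>Multiplication by the determinant \<alpha> \<delta> - \<beta> \<gamma> raises both
  degrees by one and changes nothing on SL(2).\<close>

lemma entry_monomial_raise_bidegree:
  assumes "SL2_subspace V"
    and "\<And>a c b d. a + c = A + k \<Longrightarrow> b + d = B + k \<Longrightarrow> entry_monomial a c b d \<in> V"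
    and "a + c = A" "b + d = B"
  shows "entry_monomial a c b d \<in> V"
  using assms
proof (induction k arbitrary: A B a c b d)
  case 0
  then show ?case by simp
next
  case (Suc k)
  have "entry_monomial (Suc a) c b (Suc d) \<in> V" "entry_monomial a (Suc c) (Suc b) d \<in> V"
    using Suc.prems Suc.IH[of "Suc A" "Suc B"] by auto
  then have "(\<lambda>M. entry_monomial (Suc a) c b (Suc d) M - entry_monomial a (Suc c) (Suc b) d M) \<in> V"
    by (rule SL2_subspace_diff[OF Suc.prems(1)])
  then show ?case
  proof (rule SL2_subspace_cong[OF Suc.prems(1)])
    fix M :: "'a^2^2" assume "M \<in> SL2"
    have "entry_monomial (Suc a) c b (Suc d) M - entry_monomial a (Suc c) (Suc b) d M =
        det M * entry_monomial a c b d M"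
      by (simp add: entry_monomial_def det_2 algebra_simps)
    with \<open>M \<in> SL2\<close> show "entry_monomial (Suc a) c b (Suc d) M - entry_monomial a (Suc c) (Suc b) d M =
        entry_monomial a c b d M"
      by (simp add: SL2_def)
  qed
qed

lemma polyfun_in_monomial_span:
  assumes "f \<in> polyfun mat_coords" "SL2_subspace V" "\<And>a c b d. entry_monomial a c b d \<in> V"
  shows "f \<in> V"
proof -
  \<comment> \<open>The extra monomial makes the induction close: for a product f g, the hypothesis
    for g says that all monomials lie in the subspace of those h with g h in \<open>V\<close>, to
    which the hypothesis for f applies.\<close>
  have "(\<lambda>M. f M * entry_monomial a c b d M) \<in> V" for a c b d
    using assms
  proof (induction f arbitrary: V a c b d)
    case (const x)
    then show ?case
      by (simp add: SL2_subspace_scale)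
  next
    case (coord f)
    then obtain i j :: 2 where "f = (\<lambda>A. A$i$j)"
      by (auto simp: mat_coords_def)
    then have "(\<lambda>M. f M * entry_monomial a c b d M) \<in>
        {entry_monomial (Suc a) c b d, entry_monomial a (Suc c) b d, entry_monomial a c (Suc b) d,
          entry_monomial a c b (Suc d)}"
      using exhaust_2[of i] exhaust_2[of j] unfolding entry_monomial_Suc by auto
    then show ?case
      using coord.prems(2) by auto
  next
    case (add f g)
    then show ?case
      by (simp add: distrib_right SL2_subspace_add)
  next
    case (mult f g)
    have "(\<lambda>M. f M * entry_monomial a c b d M) \<in> {h. (\<lambda>M. g M * h M) \<in> V}"
      using mult.IH(2)[OF mult.prems]
      by (intro mult.IH(1) SL2_subspace_factor mult.prems(1)) simp
    then show ?case
      by (simp add: mult_ac)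
  qed
  from this[of 0 0 0 0] show ?thesis
    by (simp add: entry_monomial_def)
qed

text \<open>The bound t \<le> A + B discards ladder entries that vanish identically; it later keeps
  the binomial coefficient of a leading term nonzero.\<close>

lemma polyfun_eq_ladder_combination:
  fixes f :: "'k::field_char_0^2^2 \<Rightarrow> 'k"
  assumes "f \<in> polyfun mat_coords"
  obtains \<kappa> where "Poly_Mapping.keys \<kappa> \<subseteq> {(A, B, t). t \<le> A + B}"
    "\<And>M. M \<in> SL2 \<Longrightarrow> f M = lincomb (\<lambda>(A, B, t). ladder A B t) \<kappa> M"
proof -
  let ?L = "\<lambda>(A, B, t). ladder A B t"
  let ?V = "{f::'k^2^2 \<Rightarrow> 'k. \<exists>\<kappa>. Poly_Mapping.keys \<kappa> \<subseteq> {(A, B, t). t \<le> A + B} \<and>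
    (\<forall>M\<in>SL2. f M = lincomb ?L \<kappa> M)}"
  have V: "SL2_subspace ?V"
    by (rule SL2_subspace_lincombs)
  have "ladder A B t \<in> ?V" for A B t
  proof (cases "t \<le> A + B")
    case True
    then show ?thesis
      by (intro CollectI exI[of _ "Poly_Mapping.single (A, B, t) 1"]) simp
  next
    case False
    then show ?thesis
      by (intro CollectI exI[of _ 0]) (simp add: ladder_beyond)
  qed
  then have "f \<in> ?V"
    by (intro polyfun_in_monomial_span[OF assms V] entry_monomial_in_ladder_span[OF V])
  then show ?thesis
    using that by blast
qed

lemma first_row_monomials_independent:
  fixes \<kappa> :: "nat \<times> nat \<Rightarrow>\<^sub>0 'k::field_char_0"
  assumes "\<And>M. M \<in> SL2 \<Longrightarrow> lincomb (\<lambda>(i, j) M. (M$1$1) ^ i * (M$1$2) ^ j) \<kappa> M = 0"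
  shows "\<kappa> = 0"
proof (rule poly_mapping_eqI)
  fix k :: "nat \<times> nat"
  have zero: "(\<Sum>i\<in>Poly_Mapping.keys \<kappa>. Poly_Mapping.lookup \<kappa> i * x ^ fst i * y ^ snd i) = 0"
    if "x \<notin> {0}" "y \<notin> {}" for x y
  proof -
    \<comment> \<open>Every first row with x nonzero completes to a matrix of determinant
      one.\<close>
    let ?M = "vector [vector [x, y], vector [0, inverse x]] :: 'k^2^2"
    have "?M \<in> SL2"
      using that by (simp add: SL2_def det_2)
    from assms[OF this] show ?thesis
      by (simp add: lincomb_def case_prod_unfold mult.assoc)
  qed
  from separate_two_exponents[OF finite_keys _ _ zero, where S = "{0}" and T = "\<lambda>_. {}" and m = "fst k" and n = "snd k"]
  have "(\<Sum>i | i \<in> Poly_Mapping.keys \<kappa> \<and> fst i = fst k \<and> snd i = snd k. Poly_Mapping.lookup \<kappa> i) = 0"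
    by simp
  also have "{i. i \<in> Poly_Mapping.keys \<kappa> \<and> fst i = fst k \<and> snd i = snd k} = Poly_Mapping.keys \<kappa> \<inter> {k}"
    by (auto simp: prod_eq_iff)
  finally show "Poly_Mapping.lookup \<kappa> k = Poly_Mapping.lookup 0 k"
    by (cases "k \<in> Poly_Mapping.keys \<kappa>") (auto simp: in_keys_iff)
qed

section \<open>The module of functions determined by the height\<close>

definition upper :: "'k::field \<Rightarrow> 'k^2^2" where
  "upper c = vector [vector [1, c], vector [0, 1]]"

lemma lower_in_SL2: "lower c \<in> SL2"
  by (simp add: lower_def SL2_def det_2)

lemma upper_in_SL2: "upper c \<in> SL2"
  by (simp add: upper_def SL2_def det_2)

lemma SL2_mult: "A \<in> SL2 \<Longrightarrow> B \<in> SL2 \<Longrightarrow> A ** B \<in> SL2"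
  by (simp add: SL2_def det_mul)

lemma ladder_mult_diag:
  "ladder A B t (M ** vector [vector [x, 0], vector [0, y]]) = x ^ A * y ^ B * ladder A B t M"
proof -
  have "[:M$1$1 * x, M$2$1 * x:] = Polynomial.smult x [:M$1$1, M$2$1:]"
    "[:M$1$2 * y, M$2$2 * y:] = Polynomial.smult y [:M$1$2, M$2$2:]"
    by (simp_all add: mult.commute)
  then show ?thesis
    by (simp only: ladder_def matrix_mult_2 vector_2 mult_zero_right add_0_left add_0_right smult_power
        mult_smult_left mult_smult_right smult_smult coeff_smult) (simp add: mult_ac)
qed

section \<open>Monomials indexed by the lattice points (a, b, m)\<close>

definition semigroup_points :: "nat \<Rightarrow> nat \<Rightarrow> nat \<Rightarrow> (int^3) set" where
  "semigroup_points p q l =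
    {u. 0 \<le> u$1 \<and> 0 \<le> u$2 \<and> u$1 \<le> int (l * q) * u$3 \<and> u$2 \<le> int (l * p) * u$3}"

text \<open>The exponents of \<gamma> and \<delta> fill up the bidegree to (l q m, l p m). Inside
  \<open>semigroup_points\<close> none of the conversions by \<open>nat\<close> truncates.\<close>

definition toric_monomial :: "nat \<Rightarrow> nat \<Rightarrow> nat \<Rightarrow> int^3 \<Rightarrow> 'k::field^2^2 \<Rightarrow> 'k" where
  "toric_monomial p q l u = entry_monomial (nat (u$1)) (nat (int (l * q) * u$3 - u$1))
    (nat (u$2)) (nat (int (l * p) * u$3 - u$2))"

lemma toric_monomial_0: "toric_monomial p q l 0 M = 1"
  by (simp add: toric_monomial_def entry_monomial_def)

lemma toric_monomial_add:
  assumes "u \<in> semigroup_points p q l" "v \<in> semigroup_points p q l"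
  shows "toric_monomial p q l (u + v) M = toric_monomial p q l u M * toric_monomial p q l v M"
proof -
  have "nat (int (l * q) * (u + v)$3 - (u + v)$1) =
      nat (int (l * q) * u$3 - u$1) + nat (int (l * q) * v$3 - v$1)"
    "nat (int (l * p) * (u + v)$3 - (u + v)$2) =
      nat (int (l * p) * u$3 - u$2) + nat (int (l * p) * v$3 - v$2)"
    "nat ((u + v)$1) = nat (u$1) + nat (v$1)" "nat ((u + v)$2) = nat (u$2) + nat (v$2)"
    using assms by (simp_all add: semigroup_points_def nat_add_distrib[symmetric] algebra_simps)
  then show ?thesis
    by (simp only: toric_monomial_def entry_monomial_def power_add) (simp only: mult_ac)
qed

lemma semigroup_points_third_nonneg:
  assumes "u \<in> semigroup_points p q l" "0 < l" "0 < q"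
  shows "0 \<le> u$3"
proof -
  have "0 \<le> int (l * q) * u$3"
    using assms(1) by (auto simp: semigroup_points_def)
  moreover have "0 < int (l * q)"
    using assms(2,3) by simp
  ultimately show ?thesis
    unfolding zero_le_mult_iff by linarith
qed

lemma semigroup_points_degrees:
  assumes "u \<in> semigroup_points p q l" "0 < l" "0 < q"
  shows "nat (u$1) + nat (int (l * q) * u$3 - u$1) = l * q * nat (u$3)"
    "nat (u$2) + nat (int (l * p) * u$3 - u$2) = l * p * nat (u$3)"
proof -
  have "int (nat (u$1) + nat (int (l * q) * u$3 - u$1)) = int (l * q * nat (u$3))"
    "int (nat (u$2) + nat (int (l * p) * u$3 - u$2)) = int (l * p * nat (u$3))"
    using assms(1) semigroup_points_third_nonneg[OF assms] by (auto simp: semigroup_points_def)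
  then show "nat (u$1) + nat (int (l * q) * u$3 - u$1) = l * q * nat (u$3)"
    "nat (u$2) + nat (int (l * p) * u$3 - u$2) = l * p * nat (u$3)"
    unfolding of_nat_eq_iff .
qed

text \<open>The weight under diag(e, 1/e) is l q m - l p m, a multiple of the order l (q -
  p).\<close>

lemma toric_monomial_mult_cyclic:
  assumes "u \<in> semigroup_points p q l" "0 < l" "p < q" "s \<in> Z_subgroup (l * (q - p))"
  shows "toric_monomial p q l u (M ** s) = toric_monomial p q l u M"
proof -
  obtain e where e: "s = vector [vector [e, 0], vector [0, inverse e]]" "e ^ (l * (q - p)) = 1"
    using assms(4) by (auto simp: Z_subgroup_def)
  have "e \<noteq> 0"
    using e(2) assms(2,3) by (auto simp: power_0_left)
  note deg = semigroup_points_degrees[OF assms(1,2) order.strict_trans1[OF le0 assms(3)]]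
  let ?m = "nat (u$3)"
  have "toric_monomial p q l u (M ** s) = e ^ (nat (u$1) + nat (int (l * q) * u$3 - u$1)) *
      inverse e ^ (nat (u$2) + nat (int (l * p) * u$3 - u$2)) * toric_monomial p q l u M"
    by (simp add: toric_monomial_def entry_monomial_def e(1) matrix_mult_2 power_mult_distrib power_add mult_ac)
  also have "l * q * ?m = l * (q - p) * ?m + l * p * ?m"
    using assms(3) by (simp flip: distrib_left distrib_right)
  then have "e ^ (nat (u$1) + nat (int (l * q) * u$3 - u$1)) *
      inverse e ^ (nat (u$2) + nat (int (l * p) * u$3 - u$2)) = (e ^ (l * (q - p))) ^ ?m * (e * inverse e) ^ (l * p * ?m)"
    unfolding deg by (simp add: power_add power_mult_distrib flip: power_mult)
  also have "\<dots> = 1"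
    using \<open>e \<noteq> 0\<close> by (simp add: e(2))
  finally show ?thesis
    by simp
qed

text \<open>With s = \<alpha>/\<gamma> and w = \<beta>/\<delta> as coordinates, the determinant
  condition becomes \<gamma> \<delta> = 1/(s - w), so \<gamma> = x is the one remaining free
  parameter. Powers of x separate the values of m, then powers of s and w separate a and b.\<close>

lemma toric_monomials_independent:
  fixes \<kappa> :: "int^3 \<Rightarrow>\<^sub>0 'k::field_char_0"
  assumes pq: "p < q" "0 < l" and keys: "Poly_Mapping.keys \<kappa> \<subseteq> semigroup_points p q l"
    and zero: "\<And>M. M \<in> SL2 \<Longrightarrow> lincomb (toric_monomial p q l) \<kappa> M = 0"
  shows "\<kappa> = 0"
proof (rule poly_mapping_eqI, simp, rule ccontr)
  fix u0 assume "Poly_Mapping.lookup \<kappa> u0 \<noteq> 0"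
  then have u0: "u0 \<in> Poly_Mapping.keys \<kappa>"
    by (simp add: in_keys_iff)
  define K where "K = Poly_Mapping.lookup \<kappa>"
  define I where "I = {u \<in> Poly_Mapping.keys \<kappa>. nat (u$3) = nat (u0$3)}"
  have third: "0 \<le> u$3" if "u \<in> Poly_Mapping.keys \<kappa>" for u
    using semigroup_points_third_nonneg keys that pq by fastforce
  have sum0: "(\<Sum>u\<in>I. K u * s ^ nat (u$1) * w ^ nat (u$2)) = 0" if "s \<notin> {}" "w \<notin> {s}" for s w :: 'k
  proof -
    define z where "z = inverse (s - w)"
    have z: "z * (s - w) = 1" "z \<noteq> 0"
      using that by (simp_all add: z_def)
    \<comment> \<open>For fixed s and w, this is the coefficient of x^(l (q - p) m): the product x y
      equals z and takes up l p m of the l q m factors x.\<close>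
    define g where "g u = K u * s ^ nat (u$1) * w ^ nat (u$2) * z ^ (l * p * nat (u$3))" for u :: "int^3"
    have "(\<Sum>u\<in>Poly_Mapping.keys \<kappa>. g u * x ^ (l * (q - p) * nat (u$3))) = 0" if "x \<notin> {0}" for x
    proof -
      define y where "y = z * inverse x"
      have "x \<noteq> 0"
        using that by simp
      define M :: "'k^2^2" where "M = vector [vector [x * s, y * w], vector [x, y]]"
      have "det M = z * (s - w)"
        using \<open>x \<noteq> 0\<close> by (simp add: M_def det_2 y_def field_simps)
      then have "M \<in> SL2"
        using z by (simp add: SL2_def)
      have "toric_monomial p q l u M =
          s ^ nat (u$1) * w ^ nat (u$2) * z ^ (l * p * nat (u$3)) * x ^ (l * (q - p) * nat (u$3))"
        if u: "u \<in> Poly_Mapping.keys \<kappa>" for u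
      proof -
        have e: "nat (u$1) + nat (int (l * q) * u$3 - u$1) = l * (q - p) * nat (u$3) + l * p * nat (u$3)"
          "nat (u$2) + nat (int (l * p) * u$3 - u$2) = l * p * nat (u$3)"
          using pq u keys semigroup_points_degrees[of u p q l] by (auto simp flip: distrib_left distrib_right)
        have "toric_monomial p q l u M = s ^ nat (u$1) * w ^ nat (u$2) *
            x ^ (nat (u$1) + nat (int (l * q) * u$3 - u$1)) * y ^ (nat (u$2) + nat (int (l * p) * u$3 - u$2))"
          by (simp add: toric_monomial_def entry_monomial_def M_def power_mult_distrib power_add mult_ac)
        also have "\<dots> = s ^ nat (u$1) * w ^ nat (u$2) *
            x ^ (l * (q - p) * nat (u$3)) * (x * y) ^ (l * p * nat (u$3))"
          unfolding e by (simp add: power_add power_mult_distrib)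
        also have "x * y = z"
          using \<open>x \<noteq> 0\<close> by (simp add: y_def)
        finally show ?thesis
          by (simp add: mult_ac)
      qed
      then have "(\<Sum>u\<in>Poly_Mapping.keys \<kappa>. g u * x ^ (l * (q - p) * nat (u$3))) =
          lincomb (toric_monomial p q l) \<kappa> M"
        unfolding lincomb_def by (intro sum.cong refl) (simp add: g_def K_def mult_ac)
      then show ?thesis
        using zero[OF \<open>M \<in> SL2\<close>] by simp
    qed
    then have "(\<Sum>u | u \<in> Poly_Mapping.keys \<kappa> \<and> l * (q - p) * nat (u$3) = l * (q - p) * nat (u0$3). g u) = 0"
      by (intro separate_exponents[where S = "{0}"]) auto
    also have "{u. u \<in> Poly_Mapping.keys \<kappa> \<and> l * (q - p) * nat (u$3) = l * (q - p) * nat (u0$3)} = I"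
      using pq by (auto simp: I_def)
    also have "(\<Sum>u\<in>I. g u) = (\<Sum>u\<in>I. K u * s ^ nat (u$1) * w ^ nat (u$2)) * z ^ (l * p * nat (u0$3))"
      unfolding sum_distrib_right by (intro sum.cong refl) (simp add: g_def I_def)
    finally show ?thesis
      using z by simp
  qed
  have "(\<Sum>u | u \<in> I \<and> nat (u$1) = nat (u0$1) \<and> nat (u$2) = nat (u0$2). K u) = 0"
    by (rule separate_two_exponents[where S = "{}" and T = "\<lambda>s. {s}", OF _ _ _ sum0]) (auto simp: I_def)
  also have "{u. u \<in> I \<and> nat (u$1) = nat (u0$1) \<and> nat (u$2) = nat (u0$2)} = {u0}"
  proof -
    \<comment> \<open>All three coordinates are nonnegative on the semigroup, so \<open>nat\<close>
      loses no information.\<close>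
    have "u = u0" if "u \<in> I" "nat (u$1) = nat (u0$1)" "nat (u$2) = nat (u0$2)" for u
    proof -
      have "u \<in> Poly_Mapping.keys \<kappa>" "nat (u$3) = nat (u0$3)"
        using that by (auto simp: I_def)
      then show ?thesis
        using that keys u0 third[of u] third[of u0] subsetD[OF keys, of u] subsetD[OF keys, of u0]
        by (auto simp: semigroup_points_def vec_eq_iff forall_3)
    qed
    then show ?thesis
      using u0 by (auto simp: I_def)
  qed
  finally show False
    using \<open>Poly_Mapping.lookup \<kappa> u0 \<noteq> 0\<close> by (simp add: K_def)
qed

text \<open>Isolates the properties of the pulled back algebra B from which its ladders are
  recovered: stability under left translation and the shape of its invariants. The condition q j
  \<le> p i is the height bound cleared of denominators.\<close>

locale height_module =
  fixes V :: "('k::{alg_closed_field, field_char_0}^2^2 \<Rightarrow> 'k) set" and p q :: nat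
  assumes subspace: "SL2_subspace V"
    and translate: "f \<in> V \<Longrightarrow> A \<in> SL2 \<Longrightarrow> (\<lambda>M. f (A ** M)) \<in> V"
    and polynomial: "f \<in> V \<Longrightarrow> \<exists>g\<in>polyfun mat_coords. \<forall>M\<in>SL2. f M = g M"
    and first_row: "q * j \<le> p * i \<Longrightarrow> (\<lambda>M. (M$1$1) ^ i * (M$1$2) ^ j) \<in> V"
    and invariant: "f \<in> V \<Longrightarrow> (\<And>c M. M \<in> SL2 \<Longrightarrow> f (lower c ** M) = f M) \<Longrightarrow>
      \<exists>\<kappa>. Poly_Mapping.keys \<kappa> \<subseteq> {(i, j). q * j \<le> p * i} \<and>
        (\<forall>M\<in>SL2. f M = lincomb (\<lambda>(i, j) M. (M$1$1) ^ i * (M$1$2) ^ j) \<kappa> M)"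
    and less: "p < q"
begin

lemma ladder_in_module:
  assumes "q * B \<le> p * A"
  shows "ladder A B t \<in> V"
proof (cases "t \<le> A + B")
  case True
  have "(\<lambda>M. \<Sum>t\<le>A + B. c ^ t * ladder A B t M) \<in> V" for c
    using translate[OF first_row[OF assms] upper_in_SL2[of c]]
    by (simp add: ladder_generating matrix_mult_2 upper_def)
  from SL2_subspace_coefficients[OF subspace this True] show ?thesis .
next
  case False
  then have "ladder A B t = (\<lambda>_. 0 :: 'k)"
    by (auto simp: ladder_beyond)
  then show ?thesis
    using SL2_subspace_0[OF subspace] by simp
qed

text \<open>
  The leading coefficient in c of the translate by lower c is a nonzero combination of highest weight
  vectors \<alpha>^A \<beta>^B with (A, B) among the keys; it lies in the module and is invariant.
\<close>

lemma ladder_combination_zero: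
  assumes V: "lincomb (\<lambda>(A, B, t). ladder A B t) \<kappa> \<in> V"
    and keys: "Poly_Mapping.keys \<kappa> \<subseteq> {(A, B, t). \<not> q * B \<le> p * A \<and> t \<le> A + B}"
  shows "\<kappa> = 0"
proof (rule ccontr)
  assume "\<kappa> \<noteq> 0"
  let ?K = "Poly_Mapping.keys \<kappa>" and ?c = "Poly_Mapping.lookup \<kappa>"
  define d where "d = Max ((\<lambda>(A, B, t). t) ` ?K)"
  have "?K \<noteq> {}"
    using \<open>\<kappa> \<noteq> 0\<close> by simp
  then have "d \<in> (\<lambda>(A, B, t). t) ` ?K"
    unfolding d_def by (intro Max_in) auto
  then obtain A0 B0 where AB0: "(A0, B0, d) \<in> ?K"
    by auto
  have d: "t \<le> d" if "(A, B, t) \<in> ?K" for A B t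
    unfolding d_def using that by (intro Max_ge) force+
  \<comment> \<open>The coefficient of c^k in the translate, from \<open>ladder_lower\<close> with s
    = t - k; the guard is needed because subtraction truncates.\<close>
  define g :: "nat \<Rightarrow> 'k^2^2 \<Rightarrow> 'k" where "g k M = (\<Sum>(A, B, t)\<in>?K. ?c (A, B, t) * (if k \<le> t
    then of_nat (A + B - (t - k) choose k) * ladder A B (t - k) M else 0))" for k M
  have "(\<lambda>M. \<Sum>k\<le>d. c ^ k * g k M) \<in> V" for c
  proof (rule SL2_subspace_cong[OF subspace translate[OF V lower_in_SL2[of c]]])
    fix M :: "'k^2^2"
    have "ladder A B t (lower c ** M) = (\<Sum>k\<le>d. c ^ k * (if k \<le> t
        then of_nat (A + B - (t - k) choose k) * ladder A B (t - k) M else 0))"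
      if "(A, B, t) \<in> ?K" for A B t
    proof -
      have "t \<le> A + B"
        using that keys by auto
      then have "ladder A B t (lower c ** M) =
          (\<Sum>k\<le>t. of_nat (A + B - (t - k) choose (t - (t - k))) * c ^ (t - (t - k)) * ladder A B (t - k) M)"
        unfolding ladder_lower[OF \<open>t \<le> A + B\<close>]
        by (intro sum.reindex_bij_witness[of _ "\<lambda>k. t - k" "\<lambda>k. t - k"]) auto
      also have "\<dots> = (\<Sum>k\<le>t. c ^ k * (if k \<le> t
          then of_nat (A + B - (t - k) choose k) * ladder A B (t - k) M else 0))"
        by (intro sum.cong) auto
      also have "\<dots> = (\<Sum>k\<le>d. c ^ k * (if k \<le> t
          then of_nat (A + B - (t - k) choose k) * ladder A B (t - k) M else 0))"
        using d[OF that] by (intro sum.mono_neutral_left) auto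
      finally show ?thesis .
    qed
    then show "lincomb (\<lambda>(A, B, t). ladder A B t) \<kappa> (lower c ** M) = (\<Sum>k\<le>d. c ^ k * g k M)"
      unfolding lincomb_def g_def sum_distrib_left
      by (subst sum.swap) (auto intro!: sum.cong simp: sum_distrib_left mult_ac)
  qed
  then have "g d \<in> V"
    by (rule SL2_subspace_coefficients[OF subspace]) simp
  let ?row = "\<lambda>(i, j) (M::'k^2^2). (M$1$1) ^ i * (M$1$2) ^ j"
  \<comment> \<open>For k = d only keys with t = d survive, each reduced to the bottom of its
    ladder, which is a monomial in the first row.\<close>
  define \<nu> where "\<nu> = (\<Sum>(A, B, t)\<in>{k \<in> ?K. snd (snd k) = d}.
    Poly_Mapping.single (A, B) (?c (A, B, t) * of_nat (A + B choose d)))"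
  have g: "g d M = lincomb ?row \<nu> M" for M
    unfolding g_def \<nu>_def lincomb_sum
    by (rule sum.mono_neutral_cong_right) (auto simp: mult_ac split: if_splits intro!: le_antisym d)
  have "g d (lower c ** M) = g d M" for c M
    by (simp add: g lincomb_def matrix_mult_2 lower_def case_prod_unfold)
  then obtain \<mu> where \<mu>: "Poly_Mapping.keys \<mu> \<subseteq> {(i, j). q * j \<le> p * i}"
    "\<And>M. M \<in> SL2 \<Longrightarrow> g d M = lincomb ?row \<mu> M"
    using invariant[OF \<open>g d \<in> V\<close>] by blast
  have "lincomb ?row (\<nu> - \<mu>) M = 0" if "M \<in> SL2" for M
    using lincomb_add[of ?row "\<nu> - \<mu>" \<mu> M] \<mu>(2)[OF that] g[of M] by simp
  then have "\<nu> - \<mu> = 0"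
    by (rule first_row_monomials_independent)
  then have "\<nu> = \<mu>"
    by simp
  \<comment> \<open>With the last index fixed at d, a single key contributes to (A0, B0), so nothing
    cancels; its binomial coefficient is nonzero since d \<le> A0 + B0.\<close>
  have "Poly_Mapping.lookup \<nu> (A0, B0) = (\<Sum>k\<in>{k \<in> ?K. snd (snd k) = d}.
      if k = (A0, B0, d) then ?c k * of_nat (A0 + B0 choose d) else 0)"
    unfolding \<nu>_def lookup_sum by (intro sum.cong refl) (auto simp: lookup_single when_def split: if_splits)
  also have "\<dots> = ?c (A0, B0, d) * of_nat (A0 + B0 choose d)"
    using AB0 by (simp add: sum.delta)
  also have "\<dots> \<noteq> 0"
    using AB0 keys by (auto simp: in_keys_iff)
  finally have "(A0, B0) \<in> Poly_Mapping.keys \<mu>"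
    using \<open>\<nu> = \<mu>\<close> by (simp add: in_keys_iff)
  then show False
    using \<mu>(1) AB0 keys by auto
qed

text \<open>The admissible part of the polynomial expansion lies in the module, hence so does the
  rest, and \<open>ladder_combination_zero\<close> makes the rest vanish.\<close>

lemma module_eq_ladder_combination:
  assumes "f \<in> V"
  obtains \<kappa> where "Poly_Mapping.keys \<kappa> \<subseteq> {(A, B, t). q * B \<le> p * A}"
    "\<And>M. M \<in> SL2 \<Longrightarrow> f M = lincomb (\<lambda>(A, B, t). ladder A B t) \<kappa> M"
proof -
  let ?L = "\<lambda>(A, B, t). ladder A B t :: 'k^2^2 \<Rightarrow> 'k"
  obtain g where g: "g \<in> polyfun mat_coords" "\<And>M. M \<in> SL2 \<Longrightarrow> f M = g M"
    using polynomial[OF assms] by blast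
  obtain \<kappa> where \<kappa>: "Poly_Mapping.keys \<kappa> \<subseteq> {(A, B, t). t \<le> A + B}"
    "\<And>M. M \<in> SL2 \<Longrightarrow> g M = lincomb ?L \<kappa> M"
    using polyfun_eq_ladder_combination[OF g(1)] by blast
  let ?I = "{(A, B, t). q * B \<le> p * A} :: (nat \<times> nat \<times> nat) set"
  obtain \<mu> \<nu> where split: "\<kappa> = \<mu> + \<nu>" "Poly_Mapping.keys \<mu> = Poly_Mapping.keys \<kappa> \<inter> ?I"
    "Poly_Mapping.keys \<nu> = Poly_Mapping.keys \<kappa> - ?I"
    by (rule poly_mapping_restrict)
  have "lincomb ?L \<mu> \<in> V"
    by (rule SL2_subspace_lincomb[OF subspace]) (auto simp: split ladder_in_module)
  then have "(\<lambda>M. f M - lincomb ?L \<mu> M) \<in> V"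
    by (rule SL2_subspace_diff[OF subspace assms])
  then have "lincomb ?L \<nu> \<in> V"
    by (rule SL2_subspace_cong[OF subspace]) (simp add: g \<kappa> split(1) lincomb_add)
  then have "\<nu> = 0"
    by (rule ladder_combination_zero) (use split(3) \<kappa>(1) in auto)
  show ?thesis
  proof (rule that[of \<mu>])
    show "Poly_Mapping.keys \<mu> \<subseteq> ?I"
      unfolding split(2) by simp
    show "f M = lincomb ?L \<mu> M" if "M \<in> SL2" for M
      using that by (simp only: g(2) \<kappa>(2) split(1) \<open>\<nu> = 0\<close> add_0_right)
  qed
qed

lemma toric_monomial_in_module:
  assumes "u \<in> semigroup_points p q l" "0 < l"
  shows "toric_monomial p q l u \<in> V"
proof -
  let ?m = "nat (u$3)"
  have e: "nat (u$1) + nat (int (l * q) * u$3 - u$1) = l * q * ?m"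
    "nat (u$2) + nat (int (l * p) * u$3 - u$2) = l * p * ?m"
    using semigroup_points_degrees[OF assms] less by simp_all
  show ?thesis
    unfolding toric_monomial_def
  proof (rule entry_monomial_in_ladder_span[OF subspace], rule ladder_in_module)
    fix k
    have "q * (l * p * ?m - k) = l * p * q * ?m - q * k"
      by (simp add: diff_mult_distrib2 mult_ac)
    also have "\<dots> \<le> l * p * q * ?m - p * k"
      using less by (intro diff_le_mono2) simp
    also have "\<dots> = p * (l * q * ?m - k)"
      by (simp add: diff_mult_distrib2 mult_ac)
    finally show "q * (nat (u$2) + nat (int (l * p) * u$3 - u$2) - k) \<le>
        p * (nat (u$1) + nat (int (l * q) * u$3 - u$1) - k)"
      unfolding e .
  qed
qed

text \<open>An invariant function equals its own average over the cyclic group, and averaging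
  removes the ladders whose weight is not divisible by r. This way no coefficients of two ladder
  expansions have to be compared.\<close>

lemma cyclic_invariant_eq_toric_combination:
  assumes "f \<in> V" and "0 < l" and r: "r = l * (q - p)"
    and inv: "\<And>s M. s \<in> Z_subgroup r \<Longrightarrow> M \<in> SL2 \<Longrightarrow> f (M ** s) = f M"
  obtains \<kappa> where "Poly_Mapping.keys \<kappa> \<subseteq> semigroup_points p q l"
    "\<And>M. M \<in> SL2 \<Longrightarrow> f M = lincomb (toric_monomial p q l) \<kappa> M"
proof -
  let ?W = "{f::'k^2^2 \<Rightarrow> 'k. \<exists>\<kappa>. Poly_Mapping.keys \<kappa> \<subseteq> semigroup_points p q l \<and>
    (\<forall>M\<in>SL2. f M = lincomb (toric_monomial p q l) \<kappa> M)}"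
  have W: "SL2_subspace ?W"
    by (rule SL2_subspace_lincombs)
  have "0 < r"
    using less assms(2) by (simp add: r)
  obtain \<kappa> where \<kappa>: "Poly_Mapping.keys \<kappa> \<subseteq> {(A, B, t). q * B \<le> p * A}"
    "\<And>M. M \<in> SL2 \<Longrightarrow> f M = lincomb (\<lambda>(A, B, t). ladder A B t) \<kappa> M"
    using module_eq_ladder_combination[OF assms(1)] by blast
  let ?K = "Poly_Mapping.keys \<kappa>" and ?c = "Poly_Mapping.lookup \<kappa>"
  \<comment> \<open>Since the height is below 1, the weight A - B is a genuine difference of natural
    numbers.\<close>
  have le: "B \<le> A" if "(A, B, t) \<in> ?K" for A B t
  proof -
    have "q * B \<le> p * A"
      using that \<kappa>(1) by auto
    also have "\<dots> \<le> q * A"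
      using less by simp
    finally show ?thesis
      using less by simp
  qed
  have average: "of_nat r * f M = (\<Sum>(A, B, t)\<in>?K.
      ?c (A, B, t) * (if r dvd A - B then of_nat r else 0) * ladder A B t M)" if M: "M \<in> SL2" for M
  proof -
    have "of_nat r * f M = (\<Sum>e | e ^ r = (1::'k). f M)"
      by (simp add: card_roots_of_unity[OF \<open>0 < r\<close>])
    also have "\<dots> = (\<Sum>e | e ^ r = 1. \<Sum>(A, B, t)\<in>?K. ?c (A, B, t) * e ^ (A - B) * ladder A B t M)"
    proof (intro sum.cong refl)
      fix e :: 'k assume "e \<in> {e. e ^ r = 1}"
      let ?s = "vector [vector [e, 0], vector [0, inverse e]] :: 'k^2^2"
      have "e \<noteq> 0"
        using \<open>e \<in> _\<close> \<open>0 < r\<close> by (auto simp: power_0_left)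
      have "?s \<in> Z_subgroup r"
        using \<open>e \<in> _\<close> by (auto simp: Z_subgroup_def)
      moreover have "?s \<in> SL2"
        using \<open>e \<noteq> 0\<close> by (simp add: SL2_def det_2)
      ultimately have "f M = lincomb (\<lambda>(A, B, t). ladder A B t) \<kappa> (M ** ?s)"
        using inv M \<kappa>(2) SL2_mult by metis
      also have "\<dots> = (\<Sum>(A, B, t)\<in>?K. ?c (A, B, t) * e ^ (A - B) * ladder A B t M)"
        unfolding lincomb_def
      proof (intro sum.cong refl)
        fix k assume "k \<in> ?K"
        then obtain A B t where k: "k = (A, B, t)" "B \<le> A"
          using le by (cases k) auto
        then have "e ^ A * inverse e ^ B = e ^ (A - B)"
          using \<open>e \<noteq> 0\<close> by (simp add: power_diff field_simps)
        then show "?c k * (case k of (A, B, t) \<Rightarrow> ladder A B t) (M ** ?s) =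
            (case k of (A, B, t) \<Rightarrow> ?c (A, B, t) * e ^ (A - B) * ladder A B t M)"
          by (simp add: k(1) ladder_mult_diag mult.assoc)
      qed
      finally show "f M = (\<Sum>(A, B, t)\<in>?K. ?c (A, B, t) * e ^ (A - B) * ladder A B t M)" .
    qed
    also have "\<dots> = (\<Sum>k\<in>?K. \<Sum>e | e ^ r = 1. case k of (A, B, t) \<Rightarrow> ?c (A, B, t) * e ^ (A - B) * ladder A B t M)"
      by (rule sum.swap)
    also have "\<dots> = (\<Sum>(A, B, t)\<in>?K. ?c (A, B, t) * (\<Sum>e | e ^ r = 1. e ^ (A - B)) * ladder A B t M)"
      by (intro sum.cong refl) (auto simp: sum_distrib_left sum_distrib_right)
    finally show ?thesis
      by (simp only: sum_powers_roots_of_unity[OF \<open>0 < r\<close>])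
  qed
  have ladder_W: "ladder A B t \<in> ?W" if "q * B \<le> p * A" "B \<le> A" "r dvd A - B" for A B t
  proof -
    obtain m where "A - B = r * m"
      using \<open>r dvd A - B\<close> by blast
    then have A: "A = B + l * (q - p) * m"
      using \<open>B \<le> A\<close> r by simp
    obtain d where d: "q = p + d" "0 < d"
      using less less_imp_add_positive by blast
    have "d * B \<le> d * (l * p * m)"
      using \<open>q * B \<le> p * A\<close> by (simp add: A d(1) algebra_simps)
    then have "B \<le> l * p * m"
      using d(2) by simp
    \<comment> \<open>Raising both degrees by k moves (A, B) to the boundary point (l q m, l p m),
      the bidegree of the toric monomials.\<close>
    then obtain k where k: "B + k = l * p * m"
      using le_Suc_ex by metis
    have "A + k = l * p * m + l * (q - p) * m"
      using A k by simp
    also have "\<dots> = l * q * m"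
      using less by (simp flip: distrib_left distrib_right)
    finally have "A + k = l * q * m" .
    have "entry_monomial a c b d \<in> ?W" if "a + c = A + k" "b + d = B + k" for a c b d
    proof -
      let ?u = "vector [int a, int b, int m] :: int^3"
      have ac: "int (l * q) * int m = int a + int c" "int (l * p) * int m = int b + int d"
        using that k \<open>A + k = l * q * m\<close> by (simp_all flip: of_nat_mult of_nat_add)
      then have "toric_monomial p q l ?u = (entry_monomial a c b d :: 'k^2^2 \<Rightarrow> 'k)"
        by (simp only: toric_monomial_def vector_3 ac add_diff_cancel_left' nat_int)
      moreover have "?u \<in> semigroup_points p q l"
        by (simp only: semigroup_points_def mem_Collect_eq vector_3 ac) simp
      ultimately show ?thesis
        by (intro CollectI exI[of _ "Poly_Mapping.single ?u 1"]) simp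
    qed
    then have "entry_monomial a c b d \<in> ?W" if "a + c = A" "b + d = B" for a c b d
      using that by (rule entry_monomial_raise_bidegree[OF W])
    then show ?thesis
      by (rule ladder_in_monomial_span[OF W])
  qed
  have "(\<lambda>M. inverse (of_nat r) * (\<Sum>(A, B, t)\<in>?K.
      ?c (A, B, t) * (if r dvd A - B then of_nat r else 0) * ladder A B t M)) \<in> ?W"
  proof (intro SL2_subspace_scale[OF W] SL2_subspace_sum[OF W])
    fix k assume "k \<in> ?K"
    then obtain A B t where k: "k = (A, B, t)" "q * B \<le> p * A" "B \<le> A"
      using \<kappa>(1) le by (cases k) auto
    show "(\<lambda>M. case k of (A, B, t) \<Rightarrow>
        ?c (A, B, t) * (if r dvd A - B then of_nat r else 0) * ladder A B t M) \<in> ?W"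
    proof (cases "r dvd A - B")
      case True
      show ?thesis
        using SL2_subspace_scale[OF W ladder_W[OF k(2,3) True]] True by (simp add: k(1))
    next
      case False
      then show ?thesis
        using SL2_subspace_0[OF W] by (simp add: k(1))
    qed
  qed
  then have "f \<in> ?W"
  proof (rule SL2_subspace_cong[OF W])
    fix M :: "'k^2^2" assume "M \<in> SL2"
    show "inverse (of_nat r) * (\<Sum>(A, B, t)\<in>?K.
      ?c (A, B, t) * (if r dvd A - B then of_nat r else 0) * ladder A B t M) = f M"
      using \<open>0 < r\<close> by (simp only: average[OF \<open>M \<in> SL2\<close>, symmetric]) (simp flip: mult.assoc)
  qed
  then show ?thesis
    by (elim CollectE exE conjE) (intro that, auto)
qed

end

section \<open>Pullback of regular functions\<close>

lemma polyfun_pullback: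
  assumes "f \<in> polyfun D" "morphism_on C X D Y F"
  shows "\<exists>g\<in>polyfun C. \<forall>x\<in>X. f (F x) = g x"
  using assms(1)
proof induction
  case (const c)
  show ?case
    by (intro bexI[of _ "\<lambda>_. c"]) (auto intro: polyfun.const)
next
  case (coord f)
  then show ?case
    using assms(2) by (auto simp: morphism_on_def)
next
  case (add f g)
  then show ?case
    by (force intro: polyfun.add)
next
  case (mult f g)
  then show ?case
    by (force intro: polyfun.mult)
qed

lemma polyfun_slice: "f \<in> polyfun (prod_coords C D) \<Longrightarrow> (\<lambda>y. f (x, y)) \<in> polyfun D"
proof (induction rule: polyfun.induct)
  case (coord f)
  then show ?case
    by (auto simp: prod_coords_def polyfun.const polyfun.coord)
qed (auto intro: polyfun.intros)

text \<open>Applied to an action, this says that each single group element acts by a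
  morphism.\<close>

lemma morphism_on_slice:
  assumes "morphism_on (prod_coords C D) (X \<times> Y) E Z (\<lambda>(x, y). F x y)" "x \<in> X"
  shows "morphism_on D Y E Z (F x)"
proof -
  have "\<exists>g\<in>polyfun D. \<forall>y\<in>Y. d (F x y) = g y" if "d \<in> E" for d
  proof -
    have "\<exists>f\<in>polyfun (prod_coords C D). \<forall>z\<in>X \<times> Y. d (case z of (x, y) \<Rightarrow> F x y) = f z"
      using assms(1) that by (simp add: morphism_on_def)
    then obtain f where f: "f \<in> polyfun (prod_coords C D)" "\<forall>z\<in>X \<times> Y. d (case z of (x, y) \<Rightarrow> F x y) = f z"
      by (rule bexE)
    show ?thesis
      using f(2) assms(2) by (intro bexI[OF _ polyfun_slice[OF f(1), of x]]) auto
  qed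
  moreover have "F x y \<in> Z" if "y \<in> Y" for y
    using assms that by (auto simp: morphism_on_def dest: funcset_mem[of _ _ _ "(x, y)"])
  ultimately show ?thesis
    by (simp add: morphism_on_def)
qed

lemma polyfun_diff:
  assumes "f \<in> polyfun C" "g \<in> polyfun C"
  shows "(\<lambda>x. f x - g x) \<in> polyfun C"
proof -
  have "(\<lambda>x. f x + (-1) * g x) \<in> polyfun C"
    by (rule polyfun.add[OF assms(1) polyfun.mult[OF polyfun.const assms(2)]])
  then show ?thesis
    by simp
qed

section \<open>Extension of identities from a dense open subset\<close>

lemma algebraic_set_zeros:
  assumes "algebraic_set Y" "f \<in> polyfun vec_coords"
  shows "algebraic_set {y \<in> Y. f y = 0}"
proof -
  obtain n S where S: "S \<subseteq> polyfun vec_coords" "Y = {x \<in> affine_space n. \<forall>f\<in>S. f x = 0}"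
    using assms(1) unfolding algebraic_set_def by blast
  then have "{y \<in> Y. f y = 0} = {x \<in> affine_space n. \<forall>f\<in>insert f S. f x = 0}"
    by auto
  then show ?thesis
    unfolding algebraic_set_def using S(1) assms(2)
    by (intro exI[of _ n] exI[of _ "insert f S"]) auto
qed

text \<open>Y is the union of two closed sets, the complement of U and the locus f = g.
  Irreducibility makes one of them all of Y, and a nonempty U excludes the first. Identities checked
  on SL(2) thereby spread to Y.\<close>

lemma polyfun_eq_from_open:
  assumes "algebraic_set Y" "irreducible_set Y" "zariski_open_in Y U" "U \<noteq> {}"
    and "f \<in> polyfun vec_coords" "g \<in> polyfun vec_coords" "\<And>y. y \<in> U \<Longrightarrow> f y = g y" "y \<in> Y"
  shows "f y = g y"
proof -
  let ?Z = "{y \<in> Y. f y - g y = 0}"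
  have "algebraic_set ?Z"
    by (intro algebraic_set_zeros polyfun_diff assms)
  moreover have "algebraic_set (Y - U)" "U \<subseteq> Y"
    using assms(3) by (auto simp: zariski_open_in_def)
  moreover have "Y \<subseteq> (Y - U) \<union> ?Z"
    using assms(7) \<open>U \<subseteq> Y\<close> by auto
  ultimately have "Y \<subseteq> Y - U \<or> Y \<subseteq> ?Z"
    using assms(2) unfolding irreducible_set_def by blast
  then show ?thesis
    using assms(4,8) \<open>U \<subseteq> Y\<close> by auto
qed

text \<open>This is B. Only values on \<open>SL2\<close> are prescribed, in keeping with
  \<open>SL2_subspace\<close>.\<close>

definition pullback :: "('k::field^2^2 \<Rightarrow> nat \<Rightarrow> 'k) \<Rightarrow> ('k^2^2 \<Rightarrow> 'k) set" where
  "pullback \<phi> = {f. \<exists>g\<in>polyfun vec_coords. \<forall>M\<in>SL2. f M = g (\<phi> M)}"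

lemma SL2_subspace_pullback: "SL2_subspace (pullback \<phi>)"
proof (rule SL2_subspaceI)
  show "(\<lambda>_. 0) \<in> pullback \<phi>"
    unfolding pullback_def by (auto intro!: bexI[of _ "\<lambda>_. 0"] polyfun.const)
next
  fix f f' assume "f \<in> pullback \<phi>" "f' \<in> pullback \<phi>"
  then obtain g g' where "g \<in> polyfun vec_coords" "\<forall>M\<in>SL2. f M = g (\<phi> M)"
    "g' \<in> polyfun vec_coords" "\<forall>M\<in>SL2. f' M = g' (\<phi> M)"
    unfolding pullback_def by blast
  then show "(\<lambda>M. f M + f' M) \<in> pullback \<phi>"
    unfolding pullback_def by (intro CollectI bexI[of _ "\<lambda>y. g y + g' y"] polyfun.add) auto
next
  fix c f assume "f \<in> pullback \<phi>"
  then obtain g where "g \<in> polyfun vec_coords" "\<forall>M\<in>SL2. f M = g (\<phi> M)"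
    unfolding pullback_def by blast
  then show "(\<lambda>M. c * f M) \<in> pullback \<phi>"
    unfolding pullback_def by (intro CollectI bexI[of _ "\<lambda>y. c * g y"] polyfun.mult polyfun.const) auto
qed (auto simp: pullback_def)

lemma mat_1_in_SL2: "mat 1 \<in> SL2"
  by (simp add: SL2_def)

lemma lower_unitriangular_eq: "(lower_unitriangular :: ('k::field^2^2) set) = range lower"
proof
  show "(lower_unitriangular :: ('k^2^2) set) \<subseteq> range lower"
  proof
    fix u :: "'k^2^2" assume "u \<in> lower_unitriangular"
    then have "u = lower (u$2$1)"
      by (auto simp: lower_unitriangular_def lower_def vec_eq_iff forall_2)
    then show "u \<in> range lower"
      by blast
  qed
qed (auto simp: lower_unitriangular_def lower_def)

lemma height_bound:
  assumes "0 < q"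
  shows "of_nat j \<le> (of_nat p / of_nat q :: rat) * of_nat i \<longleftrightarrow> q * j \<le> p * i"
proof -
  have "of_nat j \<le> (of_nat p / of_nat q :: rat) * of_nat i \<longleftrightarrow> (of_nat (q * j) :: rat) \<le> of_nat (p * i)"
    using assms by (simp add: field_simps)
  then show ?thesis
    by (simp only: of_nat_le_iff)
qed

lemma height_module_pullback:
  fixes Y :: "(nat \<Rightarrow> 'k::{alg_closed_field, field_char_0}) set"
  assumes Y: "algebraic_set Y" "irreducible_set Y" and act: "regular_SL2_action Y act"
    and height: "realizes_height Y act \<phi> (of_nat p / of_nat q)" and "p < q"
  shows "height_module (pullback \<phi>) p q"
proof -
  have "0 < q"
    using \<open>p < q\<close> by simp
  have emb: "open_equivariant_embedding Y act \<phi>"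
    and span: "(\<lambda>f. compose SL2 f \<phi>) ` invariant_functions lower_unitriangular act Y =
      height_span (of_nat p / of_nat q)"
    using height by (auto simp: realizes_height_def)
  have \<phi>: "morphism_on mat_coords SL2 vec_coords Y \<phi>" and "open": "zariski_open_in Y (\<phi> ` SL2)"
    and equi: "\<And>A B. A \<in> SL2 \<Longrightarrow> B \<in> SL2 \<Longrightarrow> \<phi> (A ** B) = act A (\<phi> B)"
    using emb by (auto simp: open_equivariant_embedding_def)
  have \<phi>Y: "\<phi> M \<in> Y" if "M \<in> SL2" for M
    using \<phi> that by (auto simp: morphism_on_def)
  have act_morphism: "morphism_on vec_coords Y vec_coords Y (act A)" if "A \<in> SL2" for A
    using act that unfolding regular_SL2_action_def by (blast intro: morphism_on_slice)
  have act_Y: "act A y \<in> Y" if "A \<in> SL2" "y \<in> Y" for A y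
    using act_morphism[OF that(1)] that(2) by (auto simp: morphism_on_def)
  show ?thesis
  proof
    show "SL2_subspace (pullback \<phi>)"
      by (rule SL2_subspace_pullback)
    show "p < q"
      by fact
  next
    fix f and A :: "'k^2^2" assume f: "f \<in> pullback \<phi>" and "A \<in> SL2"
    then obtain g where g: "g \<in> polyfun vec_coords" "\<And>M. M \<in> SL2 \<Longrightarrow> f M = g (\<phi> M)"
      unfolding pullback_def by blast
    obtain h where "h \<in> polyfun vec_coords" "\<forall>y\<in>Y. g (act A y) = h y"
      using polyfun_pullback[OF g(1) act_morphism[OF \<open>A \<in> SL2\<close>]] by blast
    then show "(\<lambda>M. f (A ** M)) \<in> pullback \<phi>"
      unfolding pullback_def using g(2) equi \<phi>Y \<open>A \<in> SL2\<close> SL2_mult by force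
  next
    fix f assume f: "f \<in> pullback \<phi>"
    then show "\<exists>g\<in>polyfun mat_coords. \<forall>M\<in>SL2. f M = g M"
      unfolding pullback_def using polyfun_pullback[OF _ \<phi>] by force
  next
    fix i j assume ij: "q * j \<le> p * i"
    let ?f = "\<lambda>M::'k^2^2. (M$1$1) ^ i * (M$1$2) ^ j"
    have "restrict ?f SL2 \<in> height_span (of_nat p / of_nat q)"
      unfolding height_span_def using ij height_bound[OF \<open>0 < q\<close>]
      by (intro CollectI exI[of _ "\<lambda>_ _. 1"] exI[of _ "{(i, j)}"]) auto
    then obtain g where "g \<in> polyfun vec_coords" and
      g: "restrict ?f SL2 = compose SL2 (restrict g Y) \<phi>"
      unfolding span[symmetric] by (auto simp: invariant_functions_def coord_ring_def)
    have "?f M = g (\<phi> M)" if "M \<in> SL2" for M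
      using fun_cong[OF g, of M] that \<phi>Y[OF that] by (simp add: compose_eq)
    then show "?f \<in> pullback \<phi>"
      unfolding pullback_def using \<open>g \<in> _\<close> by blast
  next
    fix f assume f: "f \<in> pullback \<phi>" and inv: "\<And>c M. M \<in> SL2 \<Longrightarrow> f (lower c ** M) = f M"
    then obtain g where g: "g \<in> polyfun vec_coords" "\<And>M. M \<in> SL2 \<Longrightarrow> f M = g (\<phi> M)"
      unfolding pullback_def by blast
    \<comment> \<open>The height speaks of functions invariant on all of Y, whereas invariance is
      given on SL(2) only; density of the image of \<phi> bridges the gap.\<close>
    have "g (act (lower c) y) = g y" if "y \<in> Y" for c y
    proof -
      obtain h where h: "h \<in> polyfun vec_coords" "\<forall>y\<in>Y. g (act (lower c) y) = h y"
        using polyfun_pullback[OF g(1) act_morphism[OF lower_in_SL2]] by blast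
      have "h z = g z" if z: "z \<in> \<phi> ` SL2" for z
      proof -
        obtain M where M: "M \<in> SL2" "z = \<phi> M"
          using z by blast
        then have "h z = g (\<phi> (lower c ** M))"
          using h(2) \<phi>Y equi lower_in_SL2 by metis
        also have "\<dots> = g z"
          using g(2) inv M SL2_mult lower_in_SL2 by metis
        finally show ?thesis .
      qed
      then have "h y = g y"
        using polyfun_eq_from_open[OF Y "open" _ h(1) g(1) _ that] mat_1_in_SL2 by blast
      then show ?thesis
        using h(2) that by simp
    qed
    then have "restrict g Y \<in> invariant_functions lower_unitriangular act Y"
      unfolding invariant_functions_def lower_unitriangular_eq
      using g(1) act_Y[OF lower_in_SL2] by (auto simp: coord_ring_def)
    then have "compose SL2 (restrict g Y) \<phi> \<in> height_span (of_nat p / of_nat q)"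
      unfolding span[symmetric] by blast
    then obtain c I where I: "finite I" "I \<subseteq> {(i, j). of_nat j \<le> (of_nat p / of_nat q :: rat) * of_nat i}"
      "compose SL2 (restrict g Y) \<phi> = (\<lambda>A\<in>SL2. \<Sum>(i, j)\<in>I. c i j * (A$1$1) ^ i * (A$1$2) ^ j)"
      unfolding height_span_def by blast
    let ?row = "\<lambda>(i, j) (M::'k^2^2). (M$1$1) ^ i * (M$1$2) ^ j"
    let ?W = "{f. \<exists>\<kappa>. Poly_Mapping.keys \<kappa> \<subseteq> {(i, j). q * j \<le> p * i} \<and> (\<forall>M\<in>SL2. f M = lincomb ?row \<kappa> M)}"
    have W: "SL2_subspace ?W"
      by (rule SL2_subspace_lincombs)
    have "(\<lambda>M. \<Sum>k\<in>I. c (fst k) (snd k) * ?row k M) \<in> ?W"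
    proof (intro SL2_subspace_sum[OF W] SL2_subspace_scale[OF W])
      fix k assume "k \<in> I"
      then have "k \<in> {(i, j). q * j \<le> p * i}"
        using I(2) height_bound[OF \<open>0 < q\<close>] by auto
      then show "?row k \<in> ?W"
        by (intro CollectI exI[of _ "Poly_Mapping.single k 1"]) simp
    qed
    moreover have "(\<Sum>k\<in>I. c (fst k) (snd k) * ?row k M) = f M" if "M \<in> SL2" for M
      using fun_cong[OF I(3), of M] that \<phi>Y[OF that] g(2)[OF that]
      by (simp add: compose_eq case_prod_unfold mult.assoc)
    ultimately have "f \<in> ?W"
      by (rule SL2_subspace_cong[OF W])
    then show "\<exists>\<kappa>. Poly_Mapping.keys \<kappa> \<subseteq> {(i, j). q * j \<le> p * i} \<and> (\<forall>M\<in>SL2. f M = lincomb ?row \<kappa> M)"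
      by (rule CollectD)
  qed
qed


section \<open>The cone\<close>

lemma dual_cone_generated:
  fixes S :: "(rat^'n::finite) set"
  assumes "finite S"
  shows "dual_cone (cone_generated S) = {u. \<forall>v\<in>S. 0 \<le> (\<Sum>i\<in>UNIV. u$i * v$i)}"
proof (intro subset_antisym subsetI CollectI ballI)
  fix u v assume u: "u \<in> dual_cone (cone_generated S)" and "v \<in> S"
  have "v = (\<Sum>w\<in>S. (if w = v then 1 else 0) *s w)"
    using assms \<open>v \<in> S\<close> by (subst sum.remove[of S v]) auto
  then have "v \<in> cone_generated S"
    unfolding cone_generated_def by (intro CollectI exI[of _ "\<lambda>w. if w = v then 1 else 0"]) auto
  then show "0 \<le> (\<Sum>i\<in>UNIV. u$i * v$i)"
    using u by (simp add: dual_cone_def)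
next
  fix u assume u: "u \<in> {u. \<forall>v\<in>S. 0 \<le> (\<Sum>i\<in>UNIV. u$i * v$i)}"
  have "0 \<le> (\<Sum>i\<in>UNIV. u$i * (\<Sum>v\<in>S. c v *s v)$i)" if "\<forall>v\<in>S. 0 \<le> c v" for c
  proof -
    have "(\<Sum>i\<in>UNIV. u$i * (\<Sum>v\<in>S. c v *s v)$i) = (\<Sum>i\<in>UNIV. \<Sum>v\<in>S. c v * (u$i * v$i))"
      by (simp add: sum_distrib_left mult.left_commute)
    also have "\<dots> = (\<Sum>v\<in>S. c v * (\<Sum>i\<in>UNIV. u$i * v$i))"
      by (subst sum.swap) (simp add: sum_distrib_left)
    finally show ?thesis
      using u that by (auto intro!: sum_nonneg)
  qed
  then show "u \<in> dual_cone (cone_generated S)"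
    by (auto simp: dual_cone_def cone_generated_def)
qed

abbreviation cone_rays :: "nat \<Rightarrow> nat \<Rightarrow> nat \<Rightarrow> (rat^3) set" where
  "cone_rays p q l \<equiv> {vector [1, 0, 0], vector [0, 1, 0],
     vector [-1, 0, of_nat (l * q)], vector [0, -1, of_nat (l * p)]}"

lemma dual_cone_rays:
  "dual_cone (cone_generated (cone_rays p q l)) =
    {u. 0 \<le> u$1 \<and> 0 \<le> u$2 \<and> u$1 \<le> of_nat (l * q) * u$3 \<and> u$2 \<le> of_nat (l * p) * u$3}"
  by (subst dual_cone_generated) (auto simp: sum_3 mult.commute)

lemma lattice_points_dual_cone_rays:
  "lattice_points (dual_cone (cone_generated (cone_rays p q l))) = semigroup_points p q l"
proof -
  have "rat_of_int x \<le> of_nat n * rat_of_int z \<longleftrightarrow> x \<le> int n * z" for x z n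
    by (metis of_int_le_iff of_int_mult of_int_of_nat_eq)
  then show ?thesis
    unfolding lattice_points_def dual_cone_rays semigroup_points_def by (simp del: of_nat_mult)
qed

lemma cone_rays_strongly_convex:
  assumes "0 < l" "0 < p" "0 < q"
  shows "strongly_convex_polyhedral_cone (cone_generated (cone_rays p q l))"
proof -
  have "\<forall>v. v \<in> cone_generated (cone_rays p q l) \<and> - v \<in> cone_generated (cone_rays p q l) \<longrightarrow> v = 0"
  proof (intro allI impI, elim conjE)
    fix v assume v: "v \<in> cone_generated (cone_rays p q l)" "- v \<in> cone_generated (cone_rays p q l)"
    have pair: "u$1 * v$1 + u$2 * v$2 + u$3 * v$3 = 0" if "u \<in> dual_cone (cone_generated (cone_rays p q l))" for u
    proof -
      have "0 \<le> (\<Sum>i\<in>UNIV. u$i * v$i)" "0 \<le> (\<Sum>i\<in>UNIV. u$i * (- v)$i)"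
        using that v unfolding dual_cone_def by blast+
      then show ?thesis
        by (simp add: sum_3)
    qed
    have "(1::rat) \<le> of_nat n" if "0 < n" for n
      using of_nat_mono[of 1 n, where ?'a = rat] that by simp
    \<comment> \<open>Three linearly independent points of the dual cone; a vector whose negative is
      also in the cone pairs to zero with each of them.\<close>
    from this[of "l * p"] this[of "l * q"] have "vector [0, 0, 1] \<in> dual_cone (cone_generated (cone_rays p q l))"
      "vector [1, 0, 1] \<in> dual_cone (cone_generated (cone_rays p q l))"
      "vector [0, 1, 1] \<in> dual_cone (cone_generated (cone_rays p q l))"
      unfolding dual_cone_rays using assms by (simp_all del: of_nat_mult)
    from this[THEN pair] show "v = 0"
      by (simp add: vec_eq_iff forall_3)
  qed
  moreover have "\<exists>S. finite S \<and> cone_generated (cone_rays p q l) = cone_generated S"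
    by (intro exI[of _ "cone_rays p q l"]) simp
  ultimately show ?thesis
    unfolding strongly_convex_polyhedral_cone_def by (rule conjI[rotated])
qed

section \<open>The coordinate ring of the embedding\<close>

lemma semigroup_points_add:
  "u \<in> semigroup_points p q l \<Longrightarrow> v \<in> semigroup_points p q l \<Longrightarrow> u + v \<in> semigroup_points p q l"
  by (auto simp: semigroup_points_def distrib_left intro: add_mono)

lemma Z_subgroup_in_SL2: "0 < r \<Longrightarrow> s \<in> Z_subgroup r \<Longrightarrow> s \<in> SL2"
  by (auto simp: Z_subgroup_def SL2_def det_2 power_0_left intro!: right_inverse)

text \<open>The isomorphism sends an element to its coefficients in the family \<open>b\<close>.
  Independence makes them unique, so each homomorphism law reduces to comparing values on
  \<open>D\<close>. The map \<open>ev\<close> is kept general because elements of K[X] are evaluated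
  on SL(2) through Y.\<close>

lemma algebra_isomorphic_semigroup_algebraI:
  fixes R :: "('k::field, 'a) module" and S :: "(int^'n::finite) set" and b :: "int^'n \<Rightarrow> 'b \<Rightarrow> 'k"
    and ev :: "'a \<Rightarrow> 'b \<Rightarrow> 'k"
  assumes indep: "\<And>\<kappa>. Poly_Mapping.keys \<kappa> \<subseteq> S \<Longrightarrow> (\<And>x. x \<in> D \<Longrightarrow> lincomb b \<kappa> x = 0) \<Longrightarrow> \<kappa> = 0"
    and zero: "0 \<in> S" "\<And>x. x \<in> D \<Longrightarrow> b 0 x = 1"
    and add: "\<And>u v. u \<in> S \<Longrightarrow> v \<in> S \<Longrightarrow> u + v \<in> S"
      "\<And>u v x. u \<in> S \<Longrightarrow> v \<in> S \<Longrightarrow> x \<in> D \<Longrightarrow> b (u + v) x = b u x * b v x"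
    and R_closed: "\<And>f g. f \<in> carrier R \<Longrightarrow> g \<in> carrier R \<Longrightarrow> f \<otimes>\<^bsub>R\<^esub> g \<in> carrier R"
      "\<And>f g. f \<in> carrier R \<Longrightarrow> g \<in> carrier R \<Longrightarrow> f \<oplus>\<^bsub>R\<^esub> g \<in> carrier R"
      "\<And>c f. f \<in> carrier R \<Longrightarrow> c \<odot>\<^bsub>R\<^esub> f \<in> carrier R" "\<one>\<^bsub>R\<^esub> \<in> carrier R"
    and ev: "\<And>f g x. f \<in> carrier R \<Longrightarrow> g \<in> carrier R \<Longrightarrow> x \<in> D \<Longrightarrow> ev (f \<otimes>\<^bsub>R\<^esub> g) x = ev f x * ev g x"
      "\<And>f g x. f \<in> carrier R \<Longrightarrow> g \<in> carrier R \<Longrightarrow> x \<in> D \<Longrightarrow> ev (f \<oplus>\<^bsub>R\<^esub> g) x = ev f x + ev g x"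
      "\<And>c f x. f \<in> carrier R \<Longrightarrow> x \<in> D \<Longrightarrow> ev (c \<odot>\<^bsub>R\<^esub> f) x = c * ev f x"
      "\<And>x. x \<in> D \<Longrightarrow> ev \<one>\<^bsub>R\<^esub> x = 1"
    and inj: "\<And>f g. f \<in> carrier R \<Longrightarrow> g \<in> carrier R \<Longrightarrow> (\<And>x. x \<in> D \<Longrightarrow> ev f x = ev g x) \<Longrightarrow> f = g"
    and into: "\<And>f. f \<in> carrier R \<Longrightarrow> \<exists>\<kappa>. Poly_Mapping.keys \<kappa> \<subseteq> S \<and> (\<forall>x\<in>D. ev f x = lincomb b \<kappa> x)"
    and onto: "\<And>\<kappa>. Poly_Mapping.keys \<kappa> \<subseteq> S \<Longrightarrow> \<exists>f\<in>carrier R. \<forall>x\<in>D. ev f x = lincomb b \<kappa> x"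
  shows "algebra_isomorphic R (semigroup_algebra S)"
proof -
  define \<psi> where "\<psi> f = (SOME \<kappa>. Poly_Mapping.keys \<kappa> \<subseteq> S \<and> (\<forall>x\<in>D. ev f x = lincomb b \<kappa> x))" for f
  have \<psi>: "Poly_Mapping.keys (\<psi> f) \<subseteq> S" "\<And>x. x \<in> D \<Longrightarrow> lincomb b (\<psi> f) x = ev f x" if "f \<in> carrier R" for f
    using someI_ex[OF into[OF that]] unfolding \<psi>_def[symmetric] by auto
  have unique: "\<kappa> = \<mu>" if "Poly_Mapping.keys \<kappa> \<subseteq> S" "Poly_Mapping.keys \<mu> \<subseteq> S"
    "\<And>x. x \<in> D \<Longrightarrow> lincomb b \<kappa> x = lincomb b \<mu> x" for \<kappa> \<mu> :: "int^'n \<Rightarrow>\<^sub>0 'k"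
  proof -
    have "Poly_Mapping.keys (\<kappa> - \<mu>) \<subseteq> S"
      using that(1,2) Poly_Mapping.keys_diff[of \<kappa> \<mu>] by blast
    moreover have "lincomb b (\<kappa> - \<mu>) x = 0" if "x \<in> D" for x
      using lincomb_add[of b "\<kappa> - \<mu>" \<mu> x] \<open>\<And>x. x \<in> D \<Longrightarrow> lincomb b \<kappa> x = lincomb b \<mu> x\<close>[OF that] by simp
    ultimately have "\<kappa> - \<mu> = 0"
      by (rule indep)
    then show ?thesis
      by simp
  qed
  have keys_mult: "Poly_Mapping.keys (\<kappa> * \<mu>) \<subseteq> S" if "Poly_Mapping.keys \<kappa> \<subseteq> S" "Poly_Mapping.keys \<mu> \<subseteq> S"
    for \<kappa> \<mu> :: "int^'n \<Rightarrow>\<^sub>0 'k"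
    using Poly_Mapping.keys_mult[of \<kappa> \<mu>] that add(1) by blast
  have lincomb_mult: "lincomb b (\<kappa> * \<mu>) x = lincomb b \<kappa> x * lincomb b \<mu> x"
    if "Poly_Mapping.keys \<kappa> \<subseteq> S" "Poly_Mapping.keys \<mu> \<subseteq> S" "x \<in> D" for \<kappa> \<mu> :: "int^'n \<Rightarrow>\<^sub>0 'k" and x
    using that by (intro lincomb_mult add(2)) auto
  have single0: "Poly_Mapping.keys (Poly_Mapping.single 0 c) \<subseteq> S" for c :: 'k
    using zero(1) by simp
  have "\<psi> (f \<otimes>\<^bsub>R\<^esub> g) = \<psi> f * \<psi> g" if "f \<in> carrier R" "g \<in> carrier R" for f g
    using that by (intro unique keys_mult) (simp_all add: \<psi> R_closed ev lincomb_mult)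
  moreover have "\<psi> (f \<oplus>\<^bsub>R\<^esub> g) = \<psi> f + \<psi> g" if "f \<in> carrier R" "g \<in> carrier R" for f g
  proof (rule unique)
    show "Poly_Mapping.keys (\<psi> f + \<psi> g) \<subseteq> S"
      using Poly_Mapping.keys_add[of "\<psi> f" "\<psi> g"] \<psi>(1)[OF that(1)] \<psi>(1)[OF that(2)] by blast
  qed (use that in \<open>simp_all add: \<psi> R_closed ev lincomb_add\<close>)
  moreover have "\<psi> \<one>\<^bsub>R\<^esub> = 1"
    using zero single0[of 1] by (intro unique) (simp_all add: \<psi> R_closed ev flip: single_one)
  moreover have smult: "\<psi> (c \<odot>\<^bsub>R\<^esub> f) = Poly_Mapping.single 0 c * \<psi> f" if "f \<in> carrier R" for c f
    using that by (intro unique keys_mult single0) (simp_all add: \<psi> R_closed ev lincomb_mult single0 zero)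
  moreover have "bij_betw \<psi> (carrier R) {\<kappa>. Poly_Mapping.keys \<kappa> \<subseteq> S}"
    unfolding bij_betw_def
  proof (intro conjI inj_onI subset_antisym subsetI)
    fix f g assume "f \<in> carrier R" "g \<in> carrier R" "\<psi> f = \<psi> g"
    then show "f = g"
      by (metis inj \<psi>(2))
  next
    fix \<kappa> :: "int^'n \<Rightarrow>\<^sub>0 'k" assume \<kappa>: "\<kappa> \<in> {\<kappa>. Poly_Mapping.keys \<kappa> \<subseteq> S}"
    then obtain f where "f \<in> carrier R" "\<forall>x\<in>D. ev f x = lincomb b \<kappa> x"
      using onto by blast
    moreover from this have "\<psi> f = \<kappa>"
      using \<kappa> by (intro unique) (simp_all add: \<psi>)
    ultimately show "\<kappa> \<in> \<psi> ` carrier R"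
      by blast
  qed (use \<psi>(1) in auto)
  ultimately have "\<psi> \<in> ring_iso R (semigroup_algebra S)"
    using \<psi>(1) by (auto simp: ring_iso_def ring_hom_def semigroup_algebra_def)
  then show ?thesis
    unfolding algebra_isomorphic_def using smult
    by (intro bexI[of _ \<psi>]) (simp_all add: semigroup_algebra_def)
qed

text \<open>Evaluation along SL(2) \<rightarrow> Y \<rightarrow> X identifies K[X] with the
  functions in \<open>pullback \<phi>\<close> that are invariant under right shifts by the cyclic
  group.\<close>

lemma coord_ring_isomorphic_semigroup_algebra:
  fixes X :: "(nat \<Rightarrow> 'k::{alg_closed_field, field_char_0}) set"
  assumes pq: "p < q" and "0 < l" and height: "has_height (l * (q - p)) X act (of_nat p / of_nat q)"
  shows "algebra_isomorphic (coord_ring X) (semigroup_algebra (semigroup_points p q l))"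
proof -
  define r where "r = l * (q - p)"
  obtain Y actY \<phi> \<rho> \<pi> where Y: "SL2_mod_Z_embedding 1 Y actY"
    and real: "realizes_height Y actY \<phi> (of_nat p / of_nat q)"
    and shifts: "extends_right_shifts r Y \<phi> \<rho>"
    and quot: "equivariant_quotient (Z_subgroup r) \<rho> Y actY X act \<pi>"
    using height unfolding has_height_def r_def by blast
  have "0 < r"
    using pq \<open>0 < l\<close> by (simp add: r_def)
  have alg: "algebraic_set Y" "irreducible_set Y" and actY: "regular_SL2_action Y actY"
    using Y by (auto simp: SL2_mod_Z_embedding_def)
  interpret height_module "pullback \<phi>" p q
    by (rule height_module_pullback[OF alg actY real pq])
  have "open": "zariski_open_in Y (\<phi> ` SL2)" and "morphism_on mat_coords SL2 vec_coords Y \<phi>"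
    using real by (auto simp: realizes_height_def open_equivariant_embedding_def)
  then have \<phi>Y: "\<phi> M \<in> Y" if "M \<in> SL2" for M
    using that by (auto simp: morphism_on_def)
  have dense: "f y = g y" if "f \<in> polyfun vec_coords" "g \<in> polyfun vec_coords"
    "\<And>M. M \<in> SL2 \<Longrightarrow> f (\<phi> M) = g (\<phi> M)" "y \<in> Y" for f g y
    using polyfun_eq_from_open[OF alg "open" _ that(1,2) _ that(4)] that(3) mat_1_in_SL2 by blast
  have \<rho>: "morphism_on vec_coords Y vec_coords Y (\<rho> s)" "\<And>M. M \<in> SL2 \<Longrightarrow> \<rho> s (\<phi> M) = \<phi> (M ** s)"
    if "s \<in> Z_subgroup r" for s
    using shifts that by (auto simp: extends_right_shifts_def)
  have \<rho>Y: "\<rho> s y \<in> Y" if "s \<in> Z_subgroup r" "y \<in> Y" for s y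
    using \<rho>(1)[OF that(1)] that(2) by (auto simp: morphism_on_def)
  have \<pi>: "\<pi> y \<in> X" if "y \<in> Y" for y
    using quot that by (auto simp: equivariant_quotient_def morphism_on_def)
  let ?inv = "invariant_functions (Z_subgroup r) \<rho> Y"
  have bij: "bij_betw (\<lambda>f. compose Y f \<pi>) (carrier (coord_ring X)) ?inv"
    using quot by (simp add: equivariant_quotient_def)
  have inv_poly: "\<exists>g\<in>polyfun vec_coords. f = restrict g Y" if "f \<in> ?inv" for f
    using that by (auto simp: invariant_functions_def coord_ring_def)
  have comp_inv: "compose Y f \<pi> \<in> ?inv" if "f \<in> carrier (coord_ring X)" for f
    using bij_betwE[OF bij] that by blast
  show ?thesis
  proof (rule algebra_isomorphic_semigroup_algebraI[where D = SL2 and b = "toric_monomial p q l" and ev = "\<lambda>f M. f (\<pi> (\<phi> M))"])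
    show "\<kappa> = 0" if "Poly_Mapping.keys \<kappa> \<subseteq> semigroup_points p q l"
      "\<And>M. M \<in> SL2 \<Longrightarrow> lincomb (toric_monomial p q l) \<kappa> M = 0" for \<kappa> :: "int^3 \<Rightarrow>\<^sub>0 'k"
      using toric_monomials_independent[OF pq \<open>0 < l\<close> that] .
    show "0 \<in> semigroup_points p q l"
      by (simp add: semigroup_points_def)
    show "f \<otimes>\<^bsub>coord_ring X\<^esub> g \<in> carrier (coord_ring X)" "f \<oplus>\<^bsub>coord_ring X\<^esub> g \<in> carrier (coord_ring X)"
      if fg: "f \<in> carrier (coord_ring X)" "g \<in> carrier (coord_ring X)" for f g
    proof -
      obtain f' g' where "f' \<in> polyfun vec_coords" "g' \<in> polyfun vec_coords" "f = restrict f' X" "g = restrict g' X"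
        using fg by (auto simp: coord_ring_def)
      then show "f \<otimes>\<^bsub>coord_ring X\<^esub> g \<in> carrier (coord_ring X)" "f \<oplus>\<^bsub>coord_ring X\<^esub> g \<in> carrier (coord_ring X)"
        using polyfun.mult[of f' vec_coords g'] polyfun.add[of f' vec_coords g']
        by (auto simp: coord_ring_def restrict_def fun_eq_iff intro!: exI)
    qed
    show "c \<odot>\<^bsub>coord_ring X\<^esub> f \<in> carrier (coord_ring X)" if f: "f \<in> carrier (coord_ring X)" for c f
    proof -
      obtain f' where "f' \<in> polyfun vec_coords" "f = restrict f' X"
        using f by (auto simp: coord_ring_def)
      then show ?thesis
        using polyfun.mult[OF polyfun.const[of c], of f' vec_coords]
        by (auto simp: coord_ring_def restrict_def fun_eq_iff intro!: exI)
    qed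
    show "\<one>\<^bsub>coord_ring X\<^esub> \<in> carrier (coord_ring X)"
      using polyfun.const[of 1] by (auto simp: coord_ring_def)
    \<comment> \<open>Agreement on SL(2) gives equal pullbacks to Y by density, and pulling back
      from X to Y is injective.\<close>
    show "f = g" if fg: "f \<in> carrier (coord_ring X)" "g \<in> carrier (coord_ring X)"
      "\<And>M. M \<in> SL2 \<Longrightarrow> f (\<pi> (\<phi> M)) = g (\<pi> (\<phi> M))" for f g
    proof -
      obtain f' g' where f': "f' \<in> polyfun vec_coords" "compose Y f \<pi> = restrict f' Y"
        and g': "g' \<in> polyfun vec_coords" "compose Y g \<pi> = restrict g' Y"
        using inv_poly[OF comp_inv[OF fg(1)]] inv_poly[OF comp_inv[OF fg(2)]] by blast
      have eq: "f' (\<phi> M) = g' (\<phi> M)" if "M \<in> SL2" for M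
        using fun_cong[OF f'(2), of "\<phi> M"] fun_cong[OF g'(2), of "\<phi> M"] \<phi>Y[OF that]
          fg(3)[OF that] by (simp add: compose_eq)
      have "compose Y f \<pi> = compose Y g \<pi>"
        unfolding f'(2) g'(2) by (rule restrict_ext[OF dense[OF f'(1) g'(1) eq]])
      then show ?thesis
        by (rule inj_onD[OF bij_betw_imp_inj_on[OF bij] _ fg(1,2)])
    qed
    show "\<exists>\<kappa>. Poly_Mapping.keys \<kappa> \<subseteq> semigroup_points p q l \<and>
        (\<forall>M\<in>SL2. f (\<pi> (\<phi> M)) = lincomb (toric_monomial p q l) \<kappa> M)"
      if f: "f \<in> carrier (coord_ring X)" for f
    proof -
      let ?f = "\<lambda>M. f (\<pi> (\<phi> M))"
      obtain g where g: "g \<in> polyfun vec_coords" "compose Y f \<pi> = restrict g Y"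
        using inv_poly[OF comp_inv[OF f]] by blast
      have "?f M = g (\<phi> M)" if "M \<in> SL2" for M
        using fun_cong[OF g(2), of "\<phi> M"] \<phi>Y[OF that] by (simp add: compose_eq)
      then have "?f \<in> pullback \<phi>"
        unfolding pullback_def using g(1) by blast
      moreover have "?f (M ** s) = ?f M" if s: "s \<in> Z_subgroup r" and M: "M \<in> SL2" for s M
      proof -
        have "compose Y f \<pi> (\<rho> s (\<phi> M)) = compose Y f \<pi> (\<phi> M)"
          using comp_inv[OF f] s \<phi>Y[OF M] by (simp add: invariant_functions_def)
        then show ?thesis
          using \<rho>(2)[OF s M] \<rho>Y[OF s \<phi>Y[OF M]] \<phi>Y[OF M] by (simp add: compose_eq)
      qed
      ultimately show ?thesis
        using cyclic_invariant_eq_toric_combination[OF _ \<open>0 < l\<close> r_def, of ?f] by metis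
    qed
    show "\<exists>f\<in>carrier (coord_ring X). \<forall>M\<in>SL2. f (\<pi> (\<phi> M)) = lincomb (toric_monomial p q l) \<kappa> M"
      if keys: "Poly_Mapping.keys \<kappa> \<subseteq> semigroup_points p q l" for \<kappa>
    proof -
      let ?f = "lincomb (toric_monomial p q l) \<kappa>"
      have "?f \<in> pullback \<phi>"
        using keys \<open>0 < l\<close> by (intro SL2_subspace_lincomb[OF subspace] toric_monomial_in_module) auto
      then obtain g where g: "g \<in> polyfun vec_coords" "\<And>M. M \<in> SL2 \<Longrightarrow> ?f M = g (\<phi> M)"
        unfolding pullback_def by blast
      \<comment> \<open>The toric monomials are invariant under right shifts on SL(2); for g to
        descend to the quotient X, this has to hold on all of Y.\<close>
      have "g (\<rho> s y) = g y" if s: "s \<in> Z_subgroup r" and "y \<in> Y" for s y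
      proof -
        obtain h where h: "h \<in> polyfun vec_coords" "\<forall>y\<in>Y. g (\<rho> s y) = h y"
          using polyfun_pullback[OF g(1) \<rho>(1)[OF s]] by blast
        have "h (\<phi> M) = g (\<phi> M)" if M: "M \<in> SL2" for M
        proof -
          have "M ** s \<in> SL2"
            using M s Z_subgroup_in_SL2[OF \<open>0 < r\<close>] SL2_mult by blast
          have "h (\<phi> M) = g (\<phi> (M ** s))"
            using h(2) \<phi>Y[OF M] \<rho>(2)[OF s M] by force
          also have "\<dots> = ?f (M ** s)"
            using g(2)[OF \<open>M ** s \<in> SL2\<close>] by simp
          also have "\<dots> = ?f M"
            unfolding lincomb_def using keys s pq \<open>0 < l\<close>
            by (intro sum.cong refl arg_cong2[of _ _ _ _ "(*)"] toric_monomial_mult_cyclic) (auto simp: r_def)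
          also have "\<dots> = g (\<phi> M)"
            using g(2)[OF M] .
          finally show ?thesis .
        qed
        then have "h y = g y"
          using dense[OF h(1) g(1)] \<open>y \<in> Y\<close> by blast
        then show ?thesis
          using h(2) \<open>y \<in> Y\<close> by simp
      qed
      then have "restrict g Y \<in> ?inv"
        using g(1) \<rho>Y by (auto simp: invariant_functions_def coord_ring_def)
      then obtain f where f: "f \<in> carrier (coord_ring X)" "restrict g Y = compose Y f \<pi>"
        using bij by (auto simp: bij_betw_def)
      have "f (\<pi> (\<phi> M)) = ?f M" if "M \<in> SL2" for M
        using fun_cong[OF f(2), of "\<phi> M"] \<phi>Y[OF that] g(2)[OF that] by (simp add: compose_eq)
      then show ?thesis
        using f(1) by blast
    qed
  qed (simp_all add: toric_monomial_0 toric_monomial_add semigroup_points_add coord_ring_def \<pi> \<phi>Y)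
qed

theorem proposition8:
  fixes p q l :: nat
    and X :: "(nat \<Rightarrow> 'k::{alg_closed_field, field_char_0}) set"
    and act :: "'k^2^2 \<Rightarrow> (nat \<Rightarrow> 'k) \<Rightarrow> (nat \<Rightarrow> 'k)"
  assumes "0 < p" and "p < q" and "coprime p q" and "0 < l"
    and "SL2_mod_Z_embedding (l * (q - p)) X act"
    and "has_height (l * (q - p)) X act (of_nat p / of_nat q)"
  shows "toric_with_cone X (cone_generated
    {vector [1, 0, 0], vector [0, 1, 0],
     vector [-1, 0, of_nat (l * q)], vector [0, -1, of_nat (l * p)]} :: (rat^3) set)"
  unfolding toric_with_cone_def lattice_points_dual_cone_rays
  using assms cone_rays_strongly_convex coord_ring_isomorphic_semigroup_algebra by auto

end
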